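(* Let $x>0$, let $\sigma,\mu,\xi,\zeta,\vartheta,l,m\in\mathbb{C}$, $\eta,\nu,k\in\mathbb{R}$ and $q\in\mathbb{R}^+$, with $\Re(\sigma)>0$, $\Re(\xi)>0$, $\Re(\zeta)>0$, $\Re(\vartheta)>0$, $\Re(\mu)>0$, $\Re(l)>0$, $\Re(m)>0$, $\eta>0$. Assume that $\frac{\xi}{k}$, $\frac{\nu}{\eta}$ and $\nu$ are positive real numbers and $1+\frac{\xi}{k}-q\ge 0$, and that the left-hand side below is defined and the Fox-Wright series on the right-hand side converges. Then $$B\left\{\left({}^{\eta}D^{\sigma}_{0-}\,t^\mu E^{\vartheta,q}_{k,\xi,\zeta}\big((tz)^\nu\big)\right)(x):l,m\right\}=(-1)^{-\sigma}\,\Gamma(m)\,x^{\mu-\sigma\eta}\,\frac{\eta^\sigma}{\Gamma\left(\frac{\vartheta}{k}\right)}\,k^{1-\frac{\zeta}{k}}\;{}_{3}\Psi_{3}\left[\begin{array}{c}\left(\frac{\vartheta}{k},q\right),\ \left(\frac{\mu}{\eta}+1,\frac{\nu}{\eta}\right),\ (l,\nu);\\ \left(\frac{\zeta}{k},\frac{\xi}{k}\right),\ \left(\frac{\mu}{\eta}-\sigma+1,\frac{\nu}{\eta}\right),\ (l+m,\nu);\end{array}\ k^{\,q-\frac{\xi}{k}}\,x^{\nu}\right],$$ where the Beta transform is taken with respect to the variable $z$.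
   Context: The $k$-gamma function is $\Gamma_k(\vartheta)=k^{\frac{\vartheta}{k}-1}\Gamma\left(\frac{\vartheta}{k}\right)$, and the $k$-Pochhammer symbol is $(\vartheta)_{nq,k}=k^{nq}\left(\frac{\vartheta}{k}\right)_{nq}$, where $(a)_{nq}=\Gamma(a+nq)/\Gamma(a)$. The generalized $k$-Mittag-Leffler function is $$E^{\vartheta,q}_{k,\xi,\zeta}(z)=\sum_{n=0}^\infty\frac{(\vartheta)_{nq,k}\,z^n}{\Gamma_k(n\xi+\zeta)\,n!},$$ for $k\in\mathbb{R}$, $\Re(\xi)>0$, $\Re(\zeta)>0$, $\Re(\vartheta)>0$, $q\in\mathbb{R}^+$. The Fox-Wright function is $${}_p\Psi_q\left[\begin{array}{c}(a_1,\xi_1),\dots,(a_p,\xi_p);\\ (b_1,\zeta_1),\dots,(b_q,\zeta_q);\end{array}\ z\right]=\sum_{n=0}^\infty\frac{\prod_{i=1}^p\Gamma(a_i+\xi_i n)}{\prod_{j=1}^q\Gamma(b_j+\zeta_j n)}\frac{z^n}{n!},$$ where $\xi_i,\zeta_j\in\mathbb{R}^+$ and $1+\sum_j\zeta_j-\sum_i\xi_i\ge0$ (here $p,q$ as subscripts of $\Psi$ are the numbers of parameter pairs). As usual $1/\Gamma$ is $0$ at the poles of $\Gamma$. For $\sigma\in\mathbb{C}$, $\Re(\sigma)>0$, $\eta>0$ and $n=[\Re(\sigma)]+1$ (with $[\cdot]$ the integer part), the operator ${}^{\eta}D^{\sigma}_{0-}$ is given by the formula $$\left({}^{\eta}D^{\sigma}_{0-}f(t)\right)(x)=\frac{\eta^{\sigma-n+1}}{\Gamma(n-\sigma)}\left(-x^{1-\eta}\frac{d}{dx}\right)^n\int_x^0\frac{t^{\eta-1}f(t)}{(t^\eta-x^\eta)^{\sigma-n+1}}\,dt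 ,$$ used here at $x>0$, with $\int_x^0=-\int_0^x$ (oriented integral) and complex powers of negative real numbers taken with the principal branch, $(-a)^c=e^{i\pi c}a^c$ for $a>0$; in particular $(-1)^{-\sigma}=e^{-i\pi\sigma}$. It is defined when $f$ is defined on $(0,b)$ for some $b>x$ (in particular any series defining $f$ converges there), the integral converges absolutely for all lower limits near $x$, and the indicated derivatives exist at $x$. Here, for each fixed $z\in(0,1)$, it acts on $f(t)=t^\mu E^{\vartheta,q}_{k,\xi,\zeta}((tz)^\nu)$ as a function of $t$. The Beta transform of a function $g(z)$ is $B\{g(z):l,m\}=\int_0^1 z^{l-1}(1-z)^{m-1}g(z)\,dz$. *)

theory Defs
  imports "HOL-Analysis.Analysis"
begin

text \<open>
  Powers of a real base with a complex exponent use the complex powr (principal branch), so that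
  a negative base -a gives exp (i pi c) a^c.  The library sets Gamma to 0 at its poles; together
  with x / 0 = 0 this makes a Gamma in a denominator contribute the factor 0 there, as usual.
\<close>

definition k_Gamma :: "real \<Rightarrow> complex \<Rightarrow> complex" where
  "k_Gamma k w = of_real k powr (w / of_real k - 1) * Gamma (w / of_real k)"

text \<open>The library's pochhammer only has natural indices; here the index is real.\<close>

definition real_pochhammer :: "complex \<Rightarrow> real \<Rightarrow> complex" where
  "real_pochhammer a r = Gamma (a + of_real r) / Gamma a"

definition k_pochhammer :: "real \<Rightarrow> complex \<Rightarrow> real \<Rightarrow> complex" where
  "k_pochhammer k w r = of_real k powr of_real r * real_pochhammer (w / of_real k) r"

definition k_Mittag_Leffler_term ::
  "real \<Rightarrow> complex \<Rightarrow> complex \<Rightarrow> complex \<Rightarrow> real \<Rightarrow> complex \<Rightarrow> nat \<Rightarrow> complex" where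
  "k_Mittag_Leffler_term k \<xi> \<zeta> \<theta> q z n =
     k_pochhammer k \<theta> (real n * q) * z ^ n / (k_Gamma k (of_nat n * \<xi> + \<zeta>) * fact n)"

definition k_Mittag_Leffler ::
  "real \<Rightarrow> complex \<Rightarrow> complex \<Rightarrow> complex \<Rightarrow> real \<Rightarrow> complex \<Rightarrow> complex" where
  "k_Mittag_Leffler k \<xi> \<zeta> \<theta> q z = (\<Sum>n. k_Mittag_Leffler_term k \<xi> \<zeta> \<theta> q z n)"

text \<open>The lists hold the upper and the lower parameter pairs; their lengths are the subscripts
  of Psi.\<close>

definition Fox_Wright_term ::
  "(complex \<times> real) list \<Rightarrow> (complex \<times> real) list \<Rightarrow> complex \<Rightarrow> nat \<Rightarrow> complex" where
  "Fox_Wright_term as bs z n =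
     (\<Prod>(a, \<alpha>)\<leftarrow>as. Gamma (a + of_real \<alpha> * of_nat n)) /
     (\<Prod>(b, \<beta>)\<leftarrow>bs. Gamma (b + of_real \<beta> * of_nat n)) * (z ^ n / fact n)"

definition Fox_Wright ::
  "(complex \<times> real) list \<Rightarrow> (complex \<times> real) list \<Rightarrow> complex \<Rightarrow> complex" where
  "Fox_Wright as bs z = (\<Sum>n. Fox_Wright_term as bs z n)"

definition frac_order :: "complex \<Rightarrow> nat" where
  "frac_order \<sigma> = nat \<lfloor>Re \<sigma>\<rfloor> + 1"

definition frac_integrand ::
  "real \<Rightarrow> complex \<Rightarrow> (real \<Rightarrow> complex) \<Rightarrow> real \<Rightarrow> real \<Rightarrow> complex" where
  "frac_integrand \<eta> \<sigma> f y t =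
     of_real (t powr (\<eta> - 1)) * f t /
     of_real (t powr \<eta> - y powr \<eta>) powr (\<sigma> - of_nat (frac_order \<sigma>) + 1)"

text \<open>The interval integral is oriented: for y > 0 it is minus the integral over (0, y).\<close>

definition frac_integral ::
  "real \<Rightarrow> complex \<Rightarrow> (real \<Rightarrow> complex) \<Rightarrow> real \<Rightarrow> complex" where
  "frac_integral \<eta> \<sigma> f y = (LBINT t=ereal y..0. frac_integrand \<eta> \<sigma> f y t)"

definition weighted_deriv :: "real \<Rightarrow> (real \<Rightarrow> complex) \<Rightarrow> real \<Rightarrow> complex" where
  "weighted_deriv \<eta> h y = - of_real (y powr (1 - \<eta>)) * vector_derivative h (at y)"

definition frac_deriv ::
  "real \<Rightarrow> complex \<Rightarrow> (real \<Rightarrow> complex) \<Rightarrow> real \<Rightarrow> complex" where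
  "frac_deriv \<eta> \<sigma> f x =
     of_real \<eta> powr (\<sigma> - of_nat (frac_order \<sigma>) + 1) / Gamma (of_nat (frac_order \<sigma>) - \<sigma>) *
     (weighted_deriv \<eta> ^^ frac_order \<sigma>) (frac_integral \<eta> \<sigma> f) x"

text \<open>
  Since functions are total, the set A of arguments at which f is really defined is a separate
  argument.  The last two conjuncts say that the iterated derivative of order N exists at x: the
  iterates below order N exist near x, and the last differentiation is possible at x.
\<close>

definition frac_deriv_defined ::
  "real \<Rightarrow> complex \<Rightarrow> real set \<Rightarrow> (real \<Rightarrow> complex) \<Rightarrow> real \<Rightarrow> bool" where
  "frac_deriv_defined \<eta> \<sigma> A f x \<longleftrightarrow>
     (\<exists>b>x. {0<..<b} \<subseteq> A) \<and>
     (\<forall>\<^sub>F y in nhds x. interval_lebesgue_integrable lborel (ereal y) 0 (frac_integrand \<eta> \<sigma> f y)) \<and>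
     (\<forall>j. Suc j < frac_order \<sigma> \<longrightarrow>
        (\<forall>\<^sub>F y in nhds x. (weighted_deriv \<eta> ^^ j) (frac_integral \<eta> \<sigma> f) differentiable at y)) \<and>
     (weighted_deriv \<eta> ^^ (frac_order \<sigma> - 1)) (frac_integral \<eta> \<sigma> f) differentiable at x"

definition Beta_integrand ::
  "(real \<Rightarrow> complex) \<Rightarrow> complex \<Rightarrow> complex \<Rightarrow> real \<Rightarrow> complex" where
  "Beta_integrand g l m z = of_real z powr (l - 1) * of_real (1 - z) powr (m - 1) * g z"

definition Beta_transform :: "(real \<Rightarrow> complex) \<Rightarrow> complex \<Rightarrow> complex \<Rightarrow> complex" where
  "Beta_transform g l m = (LBINT z=0..1. Beta_integrand g l m z)"

definition Beta_transform_defined :: "(real \<Rightarrow> complex) \<Rightarrow> complex \<Rightarrow> complex \<Rightarrow> bool" where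
  "Beta_transform_defined g l m \<longleftrightarrow>
     interval_lebesgue_integrable lborel 0 1 (Beta_integrand g l m)"

end

theory Submission
  imports Defs "HOL-Real_Asymp.Real_Asymp"
begin

text \<open>
  Both sides are the same power series, transformed term by term. Put \<open>s\<^sub>n = (\<mu> + \<nu> n) / \<eta>\<close> and let
  \<open>N\<close> be the order of differentiation. The substitution \<open>u = t\<^sup>\<eta>\<close> turns the integral of the \<open>n\<close>-th
  term \<open>t\<^sup>\<mu> t\<^bsup>\<nu>n\<^esup>\<close> over \<open>(0, y)\<close> into the Beta integral with parameters \<open>s\<^sub>n + 1\<close> and \<open>N - \<sigma>\<close>,
  and every application of \<open>- y\<^bsup>1-\<eta>\<^esup> d/dy\<close> lowers the argument of \<open>1 / \<Gamma>(s\<^sub>n + 1 + N - \<sigma>)\<close> by one.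
  Hence, up to a common factor, the operator multiplies the \<open>n\<close>-th coefficient by \<open>\<Gamma>(s\<^sub>n + 1) / \<Gamma>(s\<^sub>n + 1 - \<sigma>)\<close>
  (lemma \<open>frac_deriv_power_series\<close>), and the Beta transform multiplies it by
  \<open>\<Gamma>(l + \<nu> n) \<Gamma>(m) / \<Gamma>(l + m + \<nu> n)\<close> (lemma \<open>Beta_transform_power_series\<close>). The phase arises
  because \<open>t\<^sup>\<eta> - y\<^sup>\<eta>\<close> is negative: the principal branch contributes
  \<open>exp (- i \<pi> (\<sigma> - N + 1))\<close>, which the signs of the oriented integral and of the \<open>N\<close>
  derivatives complete to \<open>(-1)\<^bsup>-\<sigma>\<^esup>\<close>.

  What has to be justified is that sums may be exchanged with integrals and derivatives. For the
  fractional derivative at a fixed \<open>z < 1\<close> this is easy: as the Mittag-Leffler series converges at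
  \<open>(x z)\<^sup>\<nu>\<close> for all \<open>z < 1\<close>, its radius of convergence is at least \<open>x\<^sup>\<nu>\<close>, so that for one fixed
  \<open>z\<close> the function is given by an absolutely convergent series on an interval reaching beyond \<open>x\<close>.

  The Beta transform lets \<open>z\<close> run up to \<open>1\<close>, which may lie on the circle of convergence (this can
  happen if \<open>q = 1 + \<xi>/k\<close>). There termwise integration needs the absolute convergence of the
  Fox-Wright series, with \<open>l\<close> and \<open>m\<close> replaced by their real parts, whereas only its convergence is
  given. Stirling's formula closes this gap: at a positive argument the terms of a Fox-Wright
  series are asymptotic to \<open>C exp (A n ln n + B n) n\<^sup>\<kappa>\<close> with \<open>C \<noteq> 0\<close> and real \<open>A\<close>, \<open>B\<close>, and a series
  of this kind converges only if it converges absolutely. Indeed, if \<open>A = B = 0\<close> and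
  \<open>Re \<kappa> \<ge> -1\<close>, then the terms with indices between \<open>M\<close> and \<open>(1 + \<delta>) M\<close> have nearly the same argument,
  so their sum does not tend to zero (lemma \<open>not_summable_power_growth\<close>). Passing to the real parts
  of \<open>l\<close> and \<open>m\<close> changes \<open>\<kappa>\<close> by an imaginary number only, which does not affect absolute convergence.
\<close>

section \<open>Stirling's formula in a right half-plane\<close>

lemma not_nonpos_Int_of_Re_pos: "Re z > 0 \<Longrightarrow> z \<notin> \<int>\<^sub>\<le>\<^sub>0"
  by (auto elim!: nonpos_Ints_cases)

text \<open>The left-hand side vanishes at 0 and has derivative \<open>w\<^sup>2 / (1 + w)\<close>.\<close>

lemma Ln_one_plus_cubic_bound:
  fixes w :: complex
  assumes "norm w \<le> 1/2"
  shows "norm (Ln (1 + w) - w + w\<^sup>2 / 2) \<le> 2 * norm w ^ 3"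
proof -
  let ?f = "\<lambda>z::complex. Ln (1 + z) - z + z\<^sup>2 / 2"
  have re: "Re (1 + z) \<ge> 1/2" if "z \<in> cball 0 (norm w)" for z :: complex
    using that assms abs_Re_le_cmod[of z] by auto
  have "norm (?f w - ?f 0) \<le> (2 * norm w ^ 2) * norm (w - 0)"
  proof (rule field_differentiable_bound[where S = "cball 0 (norm w)"])
    fix z :: complex assume z: "z \<in> cball 0 (norm w)"
    have nz: "1 + z \<noteq> 0" "1 + z \<notin> \<real>\<^sub>\<le>\<^sub>0"
      using re[OF z] by (auto simp: complex_nonpos_Reals_iff complex_eq_iff)
    have "(?f has_field_derivative (1 / (1 + z) - 1 + z)) (at z within cball 0 (norm w))"
      using nz by (auto intro!: derivative_eq_intros simp: inverse_eq_divide)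
    also have "1 / (1 + z) - 1 + z = z\<^sup>2 / (1 + z)"
      using nz(1) by (simp add: divide_simps) (simp add: algebra_simps power2_eq_square)
    finally show "(?f has_field_derivative (z\<^sup>2 / (1 + z))) (at z within cball 0 (norm w))" .
    have "norm (1 + z) \<ge> 1/2" using re[OF z] complex_Re_le_cmod[of "1 + z"] by linarith
    then have "norm (z\<^sup>2 / (1 + z)) \<le> norm z ^ 2 / (1/2)"
      unfolding norm_divide norm_power by (intro divide_left_mono) auto
    also have "\<dots> \<le> 2 * norm w ^ 2"
      using z power_mono[of "norm z" "norm w" 2] by simp
    finally show "norm (z\<^sup>2 / (1 + z)) \<le> 2 * norm w ^ 2" .
  qed auto
  then show ?thesis by (simp add: power3_eq_cube power2_eq_square)
qed

text \<open>
  Stirling's approximation of Gamma without its constant factor. Growth depends on that factor only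
  through its being nonzero, which is what \<open>Stirling_quotient_limit\<close> provides.
\<close>

definition Stirling_main :: "complex \<Rightarrow> complex" where
  "Stirling_main z = exp ((z - 1/2) * Ln z - z)"

text \<open>
  The logarithm of the factor by which the approximation misses the functional equation of Gamma;
  see \<open>Stirling_main_plus1\<close>.
\<close>

definition Stirling_defect :: "complex \<Rightarrow> complex" where
  "Stirling_defect z = (z + 1/2) * Ln (1 + 1 / z) - 1"

text \<open>
  With \<open>w = 1/z\<close> the expansion of the logarithm starts with \<open>w - w\<^sup>2 / 2\<close>. The shift by \<open>1/2\<close> in the
  approximation is just what cancels the first-order term of the defect, which makes the defects
  along \<open>z, z + 1, z + 2, \<dots>\<close> summable.
\<close>

lemma norm_Stirling_defect_le:
  assumes "norm z \<ge> 2"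
  shows "norm (Stirling_defect z) \<le> 3 / norm z ^ 2"
proof -
  define w where "w = 1 / z"
  define E where "E = Ln (1 + w) - w + w\<^sup>2 / 2"
  have z: "z \<noteq> 0" using assms by auto
  have w: "norm w \<le> 1/2" "w \<noteq> 0" "z = 1 / w"
    using assms z by (auto simp: w_def norm_divide field_simps)
  have E: "norm E \<le> 2 * norm w ^ 3" unfolding E_def by (rule Ln_one_plus_cubic_bound) fact
  have "Ln (1 + w) = w - w\<^sup>2 / 2 + E" by (simp add: E_def)
  then have "Stirling_defect z = (1/w + 1/2) * (w - w\<^sup>2/2 + E) - 1"
    unfolding Stirling_defect_def w_def[symmetric] using w by simp
  also have "\<dots> = E / w - w\<^sup>2 / 4 + E / 2"
    using w(2) by (simp add: field_simps power2_eq_square)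
  finally have "norm (Stirling_defect z) \<le> norm (E / w) + norm (w\<^sup>2 / 4) + norm (E / 2)"
    by (metis norm_triangle_ineq4 norm_triangle_le add_right_mono)
  also have "\<dots> \<le> 2 * norm w ^ 2 + norm w ^ 2 / 4 + norm w ^ 2 / 2"
  proof (intro add_mono)
    show "norm (E / w) \<le> 2 * norm w ^ 2"
      using E w(2) by (simp add: norm_divide field_simps power2_eq_square power3_eq_cube)
    have "norm w ^ 3 \<le> norm w ^ 2 * (1/2)"
      unfolding power3_eq_cube power2_eq_square using w by (intro mult_left_mono) auto
    then show "norm (E / 2) \<le> norm w ^ 2 / 2" using E by (simp add: norm_divide)
  qed (simp add: norm_divide norm_power)
  also have "\<dots> \<le> 3 * norm w ^ 2" by simp
  finally show ?thesis by (simp add: w_def norm_divide power_divide)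
qed

lemma Stirling_main_plus1:
  assumes "Re z > 0"
  shows "Stirling_main (z + 1) = z * Stirling_main z * exp (Stirling_defect z)"
proof -
  have z: "z \<noteq> 0" using assms by auto
  have re: "Re (1 + 1 / z) > 0" using assms by (simp add: Re_divide add_pos_nonneg)
  then have nz: "1 + 1 / z \<noteq> 0" by (metis zero_complex.simps(1) less_irrefl)
  have "Ln (z * (1 + 1 / z)) = Ln z + Ln (1 + 1 / z)"
    using Re_Ln_pos_lt_imp[OF assms] Re_Ln_pos_lt_imp[OF re] z nz pi_gt_zero
    by (intro Ln_times_simple) auto
  moreover have "z * (1 + 1 / z) = z + 1" using z by (simp add: field_simps)
  ultimately have L: "Ln (z + 1) = Ln z + Ln (1 + 1 / z)" by simp
  have "Stirling_main (z + 1) = exp (Ln z + ((z - 1/2) * Ln z - z) + Stirling_defect z)"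
    unfolding Stirling_main_def L Stirling_defect_def
    by (rule arg_cong[of _ _ exp]) (simp add: field_simps)
  then show ?thesis using z by (simp add: exp_add Stirling_main_def)
qed

definition Stirling_quotient :: "complex \<Rightarrow> complex" where
  "Stirling_quotient z = Gamma z / Stirling_main z"

lemma Stirling_quotient_shift:
  assumes "Re z > 0"
  shows "Stirling_quotient (z + of_nat N) =
    Stirling_quotient z * exp (- (\<Sum>j<N. Stirling_defect (z + of_nat j)))"
proof (induction N)
  case (Suc N)
  have re: "Re (z + of_nat N) > 0" using assms by simp
  then have np: "z + of_nat N \<notin> \<int>\<^sub>\<le>\<^sub>0" by (rule not_nonpos_Int_of_Re_pos)
  have nz: "z + of_nat N \<noteq> 0" using re by force
  have "Stirling_quotient (z + of_nat (Suc N)) =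
        Stirling_quotient (z + of_nat N) * exp (- Stirling_defect (z + of_nat N))"
    using Stirling_main_plus1[OF re] Gamma_plus1[OF np] nz
    by (simp add: Stirling_quotient_def add_ac exp_minus divide_simps)
  then show ?case using Suc by (simp add: exp_add[symmetric] mult.assoc)
qed simp

text \<open>
  The bound \<open>3 / X\<^sup>2\<close> for a single defect is at most the telescoping difference
  \<open>3 / (X - 1) - 3 / X\<close>. The total tends to 0 as the real part of \<open>z\<close> grows, which is what makes the
  approximation asymptotically exact.
\<close>

lemma Stirling_defect_sum_bound:
  assumes "Re z \<ge> 2"
  shows "(\<Sum>j<N. norm (Stirling_defect (z + of_nat j))) \<le> 3 / (Re z - 1)"
proof -
  have "(\<Sum>j<N. norm (Stirling_defect (z + of_nat j))) \<le>
        3 / (Re z - 1) - 3 / (Re z + real N - 1)"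
  proof (induction N)
    case (Suc N)
    define X where "X = Re z + real N"
    have X: "X \<ge> 2" using assms by (simp add: X_def)
    have nX: "norm (z + of_nat N) \<ge> X" using complex_Re_le_cmod[of "z + of_nat N"] by (simp add: X_def)
    have "norm (Stirling_defect (z + of_nat N)) \<le> 3 / norm (z + of_nat N) ^ 2"
      using nX X by (intro norm_Stirling_defect_le) auto
    also have "\<dots> \<le> 3 / X ^ 2"
      using nX X by (intro divide_left_mono power_mono mult_pos_pos) auto
    also have "\<dots> \<le> 3 / (X - 1) - 3 / X"
    proof -
      have "3 / (X - 1) - 3 / X = 3 / (X * (X - 1))" using X by (simp add: field_simps)
      also have "\<dots> \<ge> 3 / X ^ 2" unfolding power2_eq_square
        using X by (intro divide_left_mono mult_left_mono mult_pos_pos) auto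
      finally show ?thesis .
    qed
    finally show ?case using Suc by (simp add: X_def algebra_simps)
  qed simp
  also have "\<dots> \<le> 3 / (Re z - 1)" using assms by simp
  finally show ?thesis .
qed

lemma summable_Stirling_defect:
  assumes "Re z \<ge> 2"
  shows "summable (\<lambda>j. norm (Stirling_defect (z + of_nat j)))"
  using Stirling_defect_sum_bound[OF assms] by (intro bounded_imp_summable[where B = "3 / (Re z - 1)"])
    (auto simp: lessThan_Suc_atMost[symmetric] simp del: sum.lessThan_Suc)

text \<open>The logarithmic form of \<open>(1 + a/X)\<^sup>X \<longlongrightarrow> exp a\<close>.\<close>

lemma tendsto_mult_Ln_one_plus_divide:
  fixes a :: complex and X :: "nat \<Rightarrow> real"
  assumes "filterlim X at_top sequentially"
  shows "(\<lambda>n. of_real (X n) * Ln (1 + a / of_real (X n))) \<longlonglongrightarrow> a"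
proof -
  have "(\<lambda>n. of_real (X n) * Ln (1 + a / of_real (X n)) - a) \<longlonglongrightarrow> 0"
  proof (rule Lim_null_comparison)
    have "eventually (\<lambda>n. X n \<ge> max 1 (2 * norm a)) sequentially"
      using assms unfolding filterlim_at_top by blast
    then show "\<forall>\<^sub>F n in sequentially.
      norm (of_real (X n) * Ln (1 + a / of_real (X n)) - a) \<le> 2 * norm a ^ 2 / X n"
    proof eventually_elim
      case (elim n)
      define w where "w = a / of_real (X n)"
      have X: "X n > 0" using elim by simp
      have nw: "norm w = norm a / X n" using X by (simp add: w_def norm_divide)
      have w: "norm w \<le> 1/2" unfolding nw using elim X by (simp add: field_simps)
      have "norm (Ln (1 + w) - w) \<le> norm w ^ 2 / (1 - norm w)"
        using w by (intro Ln_approx_linear) auto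
      also have "\<dots> \<le> norm w ^ 2 / (1/2)" using w by (intro divide_left_mono) auto
      finally have L: "norm (Ln (1 + w) - w) \<le> 2 * norm w ^ 2" by simp
      have "of_real (X n) * Ln (1 + a / of_real (X n)) - a = of_real (X n) * (Ln (1 + w) - w)"
        using X by (simp add: w_def field_simps)
      then have "norm (of_real (X n) * Ln (1 + a / of_real (X n)) - a) = X n * norm (Ln (1 + w) - w)"
        using X by (simp add: norm_mult)
      also have "\<dots> \<le> X n * (2 * norm w ^ 2)" using L X by (intro mult_left_mono) auto
      also have "\<dots> = 2 * norm a ^ 2 / X n"
        unfolding nw using X by (simp add: field_simps power2_eq_square)
      finally show ?case .
    qed
    show "(\<lambda>n. 2 * norm a ^ 2 / X n) \<longlonglongrightarrow> 0"
      by (rule real_tendsto_divide_at_top[OF tendsto_const assms])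
  qed
  then show ?thesis by (simp add: LIM_zero_iff)
qed

text \<open>
  Splitting \<open>Ln (a + X)\<close> into \<open>ln X + Ln (1 + a / X)\<close> shows that the shift \<open>a\<close> matters only through
  the exponent of \<open>X\<close>: the contribution \<open>X Ln (1 + a / X)\<close> cancels against the linear term \<open>- a\<close>.
\<close>

lemma Stirling_main_on_progression:
  fixes a :: complex and \<beta> :: real
  assumes "\<beta> > 0"
  shows "(\<lambda>n. Stirling_main (a + of_real (\<beta> * real n)) /
      exp ((a + of_real (\<beta> * real n) - 1/2) * of_real (ln (\<beta> * real n)) - of_real (\<beta> * real n)))
     \<longlonglongrightarrow> 1"
proof -
  define X where "X n = \<beta> * real n" for n
  define w where "w n = a / of_real (X n)" for n
  have Xinf: "filterlim X at_top sequentially" unfolding X_def using assms by real_asymp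
  have "filterlim (\<lambda>n. complex_of_real (X n)) at_infinity sequentially"
    by (intro filterlim_compose[OF filterlim_of_real_at_infinity Xinf])
  then have w0: "w \<longlonglongrightarrow> 0" unfolding w_def by (intro tendsto_divide_0[OF tendsto_const])
  have "(\<lambda>n. (a - 1/2) * Ln (1 + w n) + of_real (X n) * Ln (1 + w n) - a)
      \<longlonglongrightarrow> (a - 1/2) * Ln (1 + 0) + a - a"
    using tendsto_mult_Ln_one_plus_divide[OF Xinf, of a] unfolding w_def[symmetric]
    by (intro tendsto_intros w0) (auto simp: w_def)
  then have "(\<lambda>n. (a - 1/2) * Ln (1 + w n) + of_real (X n) * Ln (1 + w n) - a) \<longlonglongrightarrow> 0" by simp
  then have lim: "(\<lambda>n. exp ((a - 1/2) * Ln (1 + w n) + of_real (X n) * Ln (1 + w n) - a)) \<longlonglongrightarrow> 1"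
    using tendsto_exp by fastforce
  have ev: "eventually (\<lambda>n. norm (w n) < 1/2 \<and> X n > 0) sequentially"
    using order_tendstoD(2)[OF tendsto_norm[OF w0], of "1/2"] Xinf
    by (auto simp: filterlim_at_top_dense intro: eventually_conj)
  show ?thesis unfolding X_def[symmetric]
  proof (rule Lim_transform_eventually[OF lim])
    show "\<forall>\<^sub>F n in sequentially.
      exp ((a - 1/2) * Ln (1 + w n) + of_real (X n) * Ln (1 + w n) - a) =
      Stirling_main (a + of_real (X n)) /
      exp ((a + of_real (X n) - 1/2) * of_real (ln (X n)) - of_real (X n))"
      using ev
    proof eventually_elim
      case (elim n)
      have nz: "1 + w n \<noteq> 0"
        using elim norm_triangle_ineq2[of 1 "- w n"] by auto
      have "a + of_real (X n) = of_real (X n) * (1 + w n)"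
        using elim by (simp add: w_def field_simps)
      then have L: "Ln (a + of_real (X n)) = of_real (ln (X n)) + Ln (1 + w n)"
        using elim nz by (simp add: Ln_times_of_real Ln_of_real)
      show ?case
        unfolding Stirling_main_def L exp_diff[symmetric]
        by (rule arg_cong[of _ _ exp]) (simp add: algebra_simps)
    qed
  qed
qed


text \<open>Euler's product formula for Gamma, read as the asymptotics of Gamma along \<open>z + 1 + N\<close>.\<close>

lemma Gamma_shift_asymp:
  assumes "Re z > 0"
  shows "(\<lambda>N. Gamma (z + 1 + of_nat N) / (fact N * exp (z * of_real (ln (real N))))) \<longlonglongrightarrow> 1"
proof -
  have z: "z \<notin> \<int>\<^sub>\<le>\<^sub>0" using assms by (rule not_nonpos_Int_of_Re_pos)
  have G: "Gamma z \<noteq> 0" using z by (simp add: Gamma_eq_zero_iff)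
  have "(\<lambda>N. Gamma z / Gamma_series z N) \<longlonglongrightarrow> Gamma z / Gamma z"
    using G by (intro tendsto_intros) auto
  then have "(\<lambda>N. Gamma z / Gamma_series z N) \<longlonglongrightarrow> 1" using G by simp
  then show ?thesis
  proof (rule Lim_transform_eventually)
    show "\<forall>\<^sub>F N in sequentially. Gamma z / Gamma_series z N =
        Gamma (z + 1 + of_nat N) / (fact N * exp (z * of_real (ln (real N))))"
      using eventually_gt_at_top[of 0]
    proof eventually_elim
      case (elim N)
      have "Gamma z * pochhammer z (N + 1) = Gamma (z + of_nat (N + 1))"
        using pochhammer_Gamma[OF z, of "N + 1"] G by (simp add: field_simps)
      then show ?case by (simp add: Gamma_series_def add_ac mult_ac)
    qed
  qed
qed

lemma Stirling_quotient_shift_ratio: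
  assumes "Re z > 0"
  shows "(\<lambda>N. Stirling_quotient (z + 1 + of_nat N) / Stirling_quotient (2 + of_nat N)) \<longlonglongrightarrow> 1"
proof -
  let ?e = "\<lambda>z N. fact N * exp (z * of_real (ln (real N))) :: complex"
  let ?m = "\<lambda>(a::complex) N. exp ((a + of_real (1 * real N) - 1/2) * of_real (ln (1 * real N)) - of_real (1 * real N))"
  have "(\<lambda>N. (Gamma (z + 1 + of_nat N) / ?e z N) / (Gamma (1 + 1 + of_nat N) / ?e 1 N) /
      ((Stirling_main (z + 1 + of_real (1 * real N)) / ?m (z + 1) N) /
       (Stirling_main (2 + of_real (1 * real N)) / ?m 2 N))) \<longlonglongrightarrow> 1 / 1 / (1 / 1)"
    by (intro tendsto_divide Gamma_shift_asymp Stirling_main_on_progression assms) auto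
  then have "(\<lambda>N. (Gamma (z + 1 + of_nat N) / ?e z N) / (Gamma (1 + 1 + of_nat N) / ?e 1 N) /
      ((Stirling_main (z + 1 + of_real (1 * real N)) / ?m (z + 1) N) /
       (Stirling_main (2 + of_real (1 * real N)) / ?m 2 N))) \<longlonglongrightarrow> 1" by simp
  moreover have "(Gamma (z + 1 + of_nat N) / ?e z N) / (Gamma (1 + 1 + of_nat N) / ?e 1 N) /
      ((Stirling_main (z + 1 + of_real (1 * real N)) / ?m (z + 1) N) /
       (Stirling_main (2 + of_real (1 * real N)) / ?m 2 N)) =
     Stirling_quotient (z + 1 + of_nat N) / Stirling_quotient (2 + of_nat N)" for N
  proof -
    have "?m (z + 1) N / ?m 2 N * ?e 1 N = ?e z N"
      unfolding exp_diff[symmetric] mult.assoc[symmetric]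
      by (simp add: mult.assoc exp_add[symmetric] algebra_simps)
    moreover have "?m (z + 1) N \<noteq> 0" "?m 2 N \<noteq> 0" "?e 1 N \<noteq> 0" "?e z N \<noteq> 0" by auto
    moreover have "Stirling_main u \<noteq> 0" for u by (simp add: Stirling_main_def)
    moreover have "(A / e1) / (B / e2) / ((S1 / m1) / (S2 / m2)) = (A / S1) / (B / S2)"
      if "m1 / m2 * e2 = e1" "m1 \<noteq> 0" "m2 \<noteq> 0" "e2 \<noteq> 0" for A B S1 S2 e1 e2 m1 m2 :: complex
      using that(2-) by (simp add: that(1)[symmetric])
    ultimately show ?thesis
      unfolding Stirling_quotient_def one_add_one by (simp only: mult_1 of_real_of_nat_eq)
  qed
  ultimately show ?thesis by simp
qed

lemma Stirling_main_nonzero: "Stirling_main z \<noteq> 0"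
  by (simp add: Stirling_main_def)

text \<open>
  Moving \<open>z\<close> to \<open>z + N\<close> multiplies the quotient by the exponential of a sum of defects, and for
  \<open>N \<longlongrightarrow> \<infinity>\<close> the quotient tends to a limit that is the same for all \<open>z\<close> by
  \<open>Stirling_quotient_shift_ratio\<close>. This common limit is the constant, and the sum of all defects is
  the error.
\<close>

lemma Stirling_quotient_limit:
  obtains K where "K \<noteq> 0"
    "\<And>z. Re z \<ge> 2 \<Longrightarrow> \<exists>s. norm s \<le> 3 / (Re z - 1) \<and> Stirling_quotient z = K * exp s"
proof -
  define s where "s = (\<lambda>z. \<Sum>j. Stirling_defect (z + of_nat j))"
  have lim: "(\<lambda>N. Stirling_quotient (z + of_nat N)) \<longlonglongrightarrow> Stirling_quotient z * exp (- s z)"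
    if "Re z \<ge> 2" for z
  proof -
    have "(\<lambda>N. \<Sum>j<N. Stirling_defect (z + of_nat j)) \<longlonglongrightarrow> s z"
      unfolding s_def
      by (rule summable_LIMSEQ[OF summable_norm_cancel[OF summable_Stirling_defect[OF that]]])
    moreover have "Re z > 0" using that by simp
    ultimately show ?thesis
      unfolding Stirling_quotient_shift[OF \<open>Re z > 0\<close>] by (intro tendsto_intros)
  qed
  define K where "K = Stirling_quotient 2 * exp (- s 2)"
  have K: "K \<noteq> 0"
    using not_nonpos_Int_of_Re_pos[of 2]
    by (simp add: K_def Stirling_quotient_def Stirling_main_def Gamma_eq_zero_iff)
  have "\<exists>s. norm s \<le> 3 / (Re z - 1) \<and> Stirling_quotient z = K * exp s" if z: "Re z \<ge> 2" for z
  proof (intro exI conjI)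
    have "(\<lambda>N. Stirling_quotient (z + 1 + of_nat N)) \<longlonglongrightarrow> Stirling_quotient z * exp (- s z)"
      using LIMSEQ_Suc[OF lim[OF z]] by (simp add: add_ac)
    then have "(\<lambda>N. Stirling_quotient (z + 1 + of_nat N) / Stirling_quotient (2 + of_nat N))
       \<longlonglongrightarrow> Stirling_quotient z * exp (- s z) / K"
      using lim[of 2] K unfolding K_def by (intro tendsto_divide) auto
    moreover have "Re z > 0" using z by simp
    ultimately have "Stirling_quotient z * exp (- s z) / K = 1"
      by (rule LIMSEQ_unique[OF _ Stirling_quotient_shift_ratio])
    then show "Stirling_quotient z = K * exp (s z)" using K by (simp add: exp_minus field_simps)
    have "norm (s z) \<le> (\<Sum>j. norm (Stirling_defect (z + of_nat j)))"
      unfolding s_def by (intro summable_norm summable_Stirling_defect z)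
    also have "\<dots> \<le> 3 / (Re z - 1)"
      by (intro suminf_le_const summable_Stirling_defect Stirling_defect_sum_bound z)
    finally show "norm (s z) \<le> 3 / (Re z - 1)" .
  qed
  with K that show thesis by blast
qed

lemma Gamma_on_progression:
  fixes a :: complex and \<beta> :: real
  assumes "\<beta> > 0"
  obtains K where "K \<noteq> 0"
    "(\<lambda>n. Gamma (a + of_real (\<beta> * real n)) /
      exp ((a + of_real (\<beta> * real n) - 1/2) * of_real (ln (\<beta> * real n)) - of_real (\<beta> * real n)))
     \<longlonglongrightarrow> K"
proof -
  obtain K s where K: "K \<noteq> 0" and s:
    "\<And>z. Re z \<ge> 2 \<Longrightarrow> norm (s z) \<le> 3 / (Re z - 1)"
    "\<And>z. Re z \<ge> 2 \<Longrightarrow> Stirling_quotient z = K * exp (s z)"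
    using Stirling_quotient_limit by metis
  define z where "z = (\<lambda>n. a + of_real (\<beta> * real n))"
  have re: "filterlim (\<lambda>n. Re (z n)) at_top sequentially"
  proof -
    have "filterlim (\<lambda>n. Re a + \<beta> * real n) at_top sequentially" using assms by real_asymp
    then show ?thesis by (simp add: z_def)
  qed
  have ev: "eventually (\<lambda>n. Re (z n) \<ge> 2) sequentially"
    using re unfolding filterlim_at_top by blast
  have "(\<lambda>n. s (z n)) \<longlonglongrightarrow> 0"
  proof (rule Lim_null_comparison)
    show "\<forall>\<^sub>F n in sequentially. norm (s (z n)) \<le> 3 / (Re (z n) - 1)"
      using ev by eventually_elim (rule s)
    show "(\<lambda>n. 3 / (Re (z n) - 1)) \<longlonglongrightarrow> 0"
      using filterlim_tendsto_add_at_top[OF tendsto_const[of "-1"] re]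
      by (intro real_tendsto_divide_at_top[OF tendsto_const]) simp
  qed
  then have "(\<lambda>n. K * exp (s (z n))) \<longlonglongrightarrow> K * exp 0" by (intro tendsto_intros)
  then have "(\<lambda>n. Stirling_quotient (z n)) \<longlonglongrightarrow> K * exp 0"
    by (rule Lim_transform_eventually) (use ev in eventually_elim, simp add: s)
  from tendsto_mult[OF this Stirling_main_on_progression[OF assms, of a]]
  have "(\<lambda>n. Gamma (a + of_real (\<beta> * real n)) /
      exp ((a + of_real (\<beta> * real n) - 1/2) * of_real (ln (\<beta> * real n)) - of_real (\<beta> * real n)))
     \<longlonglongrightarrow> K"
    unfolding z_def Stirling_quotient_def times_divide_times_eq
    by (simp add: Stirling_main_nonzero)
  with K that show thesis by blast
qed

section \<open>Series whose terms grow like products of Gamma functions\<close>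

text \<open>
  The growth class \<open>C exp (A n ln n + B n) n\<^sup>\<kappa>\<close> with \<open>C \<noteq> 0\<close>. The exponent \<open>\<kappa>\<close> is complex because
  a Gamma function with a complex shift oscillates like an imaginary power of \<open>n\<close>. The class is
  closed under products and quotients, which reduces Fox-Wright terms to single Gamma functions.
\<close>

definition Stirling_growth :: "(nat \<Rightarrow> complex) \<Rightarrow> real \<Rightarrow> complex \<Rightarrow> real \<Rightarrow> bool" where
  "Stirling_growth g A \<kappa> B \<longleftrightarrow> (\<exists>C. C \<noteq> 0 \<and>
     (\<lambda>n. g n / exp (of_real (A * (real n * ln (real n)) + B * real n) + \<kappa> * of_real (ln (real n)))) \<longlonglongrightarrow> C)"

lemma Stirling_growth_mult:
  assumes "Stirling_growth f A \<kappa> B" "Stirling_growth g A' \<kappa>' B'"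
  shows "Stirling_growth (\<lambda>n. f n * g n) (A + A') (\<kappa> + \<kappa>') (B + B')"
proof -
  let ?e = "\<lambda>A \<kappa> B n. exp (of_real (A * (real n * ln (real n)) + B * real n) + \<kappa> * of_real (ln (real n)))"
  obtain C D where C: "C \<noteq> 0" "(\<lambda>n. f n / ?e A \<kappa> B n) \<longlonglongrightarrow> C"
    and D: "D \<noteq> 0" "(\<lambda>n. g n / ?e A' \<kappa>' B' n) \<longlonglongrightarrow> D"
    using assms unfolding Stirling_growth_def by blast
  have "?e (A + A') (\<kappa> + \<kappa>') (B + B') n = ?e A \<kappa> B n * ?e A' \<kappa>' B' n" for n
    unfolding exp_add[symmetric] by (rule arg_cong[of _ _ exp]) (simp add: algebra_simps)
  then have "(\<lambda>n. f n * g n / ?e (A + A') (\<kappa> + \<kappa>') (B + B') n) \<longlonglongrightarrow> C * D"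
    using tendsto_mult[OF C(2) D(2)] by (simp only: times_divide_times_eq)
  then show ?thesis unfolding Stirling_growth_def using C(1) D(1)
    by (intro exI[of _ "C * D"]) simp
qed

lemma Stirling_growth_divide:
  assumes "Stirling_growth f A \<kappa> B" "Stirling_growth g A' \<kappa>' B'"
  shows "Stirling_growth (\<lambda>n. f n / g n) (A - A') (\<kappa> - \<kappa>') (B - B')"
proof -
  let ?e = "\<lambda>A \<kappa> B n. exp (of_real (A * (real n * ln (real n)) + B * real n) + \<kappa> * of_real (ln (real n)))"
  obtain C D where C: "C \<noteq> 0" "(\<lambda>n. f n / ?e A \<kappa> B n) \<longlonglongrightarrow> C"
    and D: "D \<noteq> 0" "(\<lambda>n. g n / ?e A' \<kappa>' B' n) \<longlonglongrightarrow> D"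
    using assms unfolding Stirling_growth_def by blast
  have "?e (A - A') (\<kappa> - \<kappa>') (B - B') n = ?e A \<kappa> B n / ?e A' \<kappa>' B' n" for n
    unfolding exp_diff[symmetric] by (rule arg_cong[of _ _ exp]) (simp add: algebra_simps)
  then have "f n / g n / ?e (A - A') (\<kappa> - \<kappa>') (B - B') n =
      (f n / ?e A \<kappa> B n) / (g n / ?e A' \<kappa>' B' n)" for n
    by (simp only: divide_divide_times_eq) (simp add: mult.commute)
  then have "(\<lambda>n. f n / g n / ?e (A - A') (\<kappa> - \<kappa>') (B - B') n) \<longlonglongrightarrow> C / D"
    using tendsto_divide[OF C(2) D(2) D(1)] by (simp only:)
  then show ?thesis unfolding Stirling_growth_def using C(1) D(1)
    by (intro exI[of _ "C / D"]) simp
qed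

lemma Stirling_growth_Gamma:
  assumes "\<beta> > 0"
  shows "Stirling_growth (\<lambda>n. Gamma (a + of_real \<beta> * of_nat n)) \<beta> (a - 1/2) (\<beta> * ln \<beta> - \<beta>)"
proof -
  let ?m = "\<lambda>n. exp ((a + of_real (\<beta> * real n) - 1/2) * of_real (ln (\<beta> * real n)) - of_real (\<beta> * real n))"
  let ?e = "\<lambda>n. exp (of_real (\<beta> * (real n * ln (real n)) + (\<beta> * ln \<beta> - \<beta>) * real n) + (a - 1/2) * of_real (ln (real n)))"
  define c where "c = exp ((a - 1/2) * of_real (ln \<beta>))"
  obtain K where K: "K \<noteq> 0" "(\<lambda>n. Gamma (a + of_real (\<beta> * real n)) / ?m n) \<longlonglongrightarrow> K"
    using Gamma_on_progression[OF assms] by blast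
  have "(\<lambda>n. c * (Gamma (a + of_real (\<beta> * real n)) / ?m n)) \<longlonglongrightarrow> c * K"
    by (intro tendsto_intros K)
  then have "(\<lambda>n. Gamma (a + of_real \<beta> * of_nat n) / ?e n) \<longlonglongrightarrow> c * K"
  proof (rule Lim_transform_eventually)
    show "\<forall>\<^sub>F n in sequentially. c * (Gamma (a + of_real (\<beta> * real n)) / ?m n) =
        Gamma (a + of_real \<beta> * of_nat n) / ?e n"
      using eventually_gt_at_top[of 0]
    proof eventually_elim
      case (elim n)
      have "?m n = c * ?e n"
        unfolding c_def exp_add[symmetric] ln_mult_pos[OF assms, of "real n", simplified, OF elim]
        by (rule arg_cong[of _ _ exp]) (simp add: algebra_simps)
      then show ?case by (simp add: c_def)
    qed
  qed
  then show ?thesis unfolding Stirling_growth_def using K(1) by (intro exI[of _ "c * K"]) (simp add: c_def)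
qed

lemma Stirling_growth_power:
  assumes "c > 0"
  shows "Stirling_growth (\<lambda>n. of_real c ^ n) 0 0 (ln c)"
  unfolding Stirling_growth_def
proof (intro exI[of _ 1] conjI)
  have "exp (of_real (0 * (real n * ln (real n)) + ln c * real n) + 0 * of_real (ln (real n))) = (of_real c :: complex) ^ n" for n
    using assms by (simp add: exp_of_real exp_of_nat2_mult)
  then show "(\<lambda>n. of_real c ^ n / exp (of_real (0 * (real n * ln (real n)) + ln c * real n) + 0 * of_real (ln (real n)))) \<longlonglongrightarrow> (1::complex)"
    using assms by simp
qed simp

lemma Stirling_growth_const:
  assumes "c \<noteq> 0"
  shows "Stirling_growth (\<lambda>n. c) 0 0 0"
  using assms unfolding Stirling_growth_def by (intro exI[of _ c]) simp

lemma Stirling_growth_fact: "Stirling_growth (\<lambda>n. fact n) 1 (1/2) (-1)"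
  using Stirling_growth_Gamma[of 1 1] by (simp add: Gamma_fact)

lemma Stirling_growth_norm_limit:
  assumes "Stirling_growth g A \<kappa> B"
  obtains c where "c > 0"
    "(\<lambda>n. norm (g n) / exp (A * (real n * ln (real n)) + B * real n + Re \<kappa> * ln (real n))) \<longlonglongrightarrow> c"
proof -
  obtain C where C: "C \<noteq> 0" "(\<lambda>n. g n / exp (of_real (A * (real n * ln (real n)) + B * real n) + \<kappa> * of_real (ln (real n)))) \<longlonglongrightarrow> C"
    using assms unfolding Stirling_growth_def by blast
  from tendsto_norm[OF C(2)] show ?thesis
    using C(1) by (intro that[of "norm C"]) (simp_all add: norm_divide)
qed

text \<open>
  Dividing by \<open>C N\<^sup>\<kappa>\<close> turns each term with index in a block from \<open>N\<close> to \<open>(1 + \<delta>) N\<close> into a number close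
  to 1, because \<open>ln n - ln N \<le> \<delta>\<close> there. The block has about \<open>\<delta> N\<close> terms of size at least a multiple of
  \<open>1 / N\<close>, so the block sums stay away from 0, against Cauchy's criterion.
\<close>

lemma not_summable_power_growth:
  fixes f :: "nat \<Rightarrow> complex"
  assumes "C \<noteq> 0" and lim: "(\<lambda>n. f n / exp (\<kappa> * of_real (ln (real n)))) \<longlonglongrightarrow> C" and re: "Re \<kappa> \<ge> -1"
  shows "\<not> summable f"
proof
  assume f: "summable f"
  define u where "u n = f n / exp (\<kappa> * of_real (ln (real n))) / C" for n
  have "u \<longlonglongrightarrow> C / C" unfolding u_def using assms by (intro tendsto_intros) auto
  then have u1: "u \<longlonglongrightarrow> 1" using assms by simp
  have "((\<lambda>h. exp (\<kappa> * of_real h)) \<longlongrightarrow> exp (\<kappa> * of_real 0)) (at (0::real))"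
    by (intro tendsto_intros)
  then have "\<forall>\<^sub>F h in at (0::real). dist (exp (\<kappa> * of_real h)) 1 < 1/4"
    by (intro tendstoD) auto
  then obtain \<delta>' where \<delta>': "\<delta>' > 0" "\<And>h. h \<noteq> 0 \<Longrightarrow> \<bar>h\<bar> < \<delta>' \<Longrightarrow> dist (exp (\<kappa> * of_real h)) 1 < 1/4"
    unfolding eventually_at by (auto simp: dist_real_def)
  define \<delta> where "\<delta> = \<delta>' / 2"
  have \<delta>: "norm (exp (\<kappa> * of_real h) - 1) \<le> 1/4" if "0 \<le> h" "h \<le> \<delta>" for h
    using \<delta>' that by (cases "h = 0"; force simp: \<delta>_def dist_norm)
  have \<delta>0: "\<delta> > 0" using \<delta>' by (simp add: \<delta>_def)
  define e where "e = norm C * \<delta> / 8"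
  have "e > 0" using \<delta>0 assms by (simp add: e_def)
  then obtain N0 where N0: "\<And>m n. m \<ge> N0 \<Longrightarrow> norm (sum f {m..<n}) < e"
    using f unfolding summable_Cauchy by meson
  obtain N1 where N1: "\<And>n. n \<ge> N1 \<Longrightarrow> norm (u n - 1) < 1/4"
    using LIMSEQ_D[OF u1, of "1/4"] by auto
  define N where "N = N0 + N1 + nat \<lceil>2 / \<delta>\<rceil> + 1"
  have N: "N \<ge> N0" "N \<ge> N1" "real N \<ge> 1" "real N \<ge> 2 / \<delta>" by (auto simp: N_def) linarith
  define M where "M = nat \<lfloor>\<delta> * real N\<rfloor>"
  have dN: "\<delta> * real N \<ge> 2" using N(4) \<delta>0 by (simp add: field_simps)
  have M: "real M \<le> \<delta> * real N" "real M \<ge> \<delta> * real N / 2"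
    using dN by (auto simp: M_def) linarith
  \<comment> \<open>\<open>P\<close> is \<open>N\<^sup>\<kappa>\<close>. An error of at most \<open>1/4\<close> in each of the two factors of \<open>f n / (C P)\<close> keeps its real part
     above \<open>1 - 9/16\<close>.\<close>
  define P where "P = exp (\<kappa> * of_real (ln (real N)))"
  have term_bd: "Re (f n / (C * P)) \<ge> 7/16" if n: "n \<in> {N..<N + M}" for n
  proof -
    define h where "h = ln (real n) - ln (real N)"
    have n': "N \<le> n" "real n \<le> real N + \<delta> * real N" using n M(1) by auto
    have h: "0 \<le> h" "h \<le> \<delta>"
    proof -
      show "0 \<le> h" unfolding h_def using n' N(3) by simp
      have "h = ln (real n / real N)" unfolding h_def using n' N(3) by (subst ln_div) auto
      also have "\<dots> \<le> real n / real N - 1" using n' N(3) by (intro ln_le_minus_one) auto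
      also have "\<dots> \<le> \<delta>" using n' N(3) by (simp add: field_simps)
      finally show "h \<le> \<delta>" .
    qed
    define v where "v = exp (\<kappa> * of_real h)"
    have v: "norm (v - 1) \<le> 1/4" unfolding v_def by (rule \<delta>[OF h])
    have u: "norm (u n - 1) \<le> 1/4" using N1[of n] n' N(2) by simp
    have "exp (\<kappa> * of_real (ln (real n))) = v * P"
      unfolding v_def P_def exp_add[symmetric] h_def by (simp add: algebra_simps)
    then have "f n = u n * v * P * C" using assms(1) by (simp add: u_def v_def P_def)
    then have eq: "f n / (C * P) = u n * v" using assms(1) by (simp add: P_def)
    have "norm v \<le> 5/4" using v norm_triangle_ineq[of "v - 1" 1] by simp
    then have "norm ((u n - 1) * v) \<le> 1/4 * (5/4)" unfolding norm_mult using u by (intro mult_mono) auto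
    moreover have eq': "u n * v - 1 = (u n - 1) * v + (v - 1)" by (simp add: algebra_simps)
    ultimately have "norm (u n * v - 1) \<le> 9/16"
      unfolding eq' using norm_triangle_ineq[of "(u n - 1) * v" "v - 1"] v by linarith
    then show ?thesis unfolding eq using abs_Re_le_cmod[of "u n * v - 1"] by simp
  qed
  have "real M * (7/16) = (\<Sum>n\<in>{N..<N+M}. 7/16)" by simp
  also have "\<dots> \<le> (\<Sum>n\<in>{N..<N+M}. Re (f n / (C * P)))" by (intro sum_mono term_bd)
  also have "\<dots> = Re (sum f {N..<N+M} / (C * P))" by (simp add: sum_divide_distrib)
  also have "\<dots> \<le> norm (sum f {N..<N+M} / (C * P))" by (rule complex_Re_le_cmod)
  also have "\<dots> = norm (sum f {N..<N+M}) / (norm C * norm P)" by (simp add: norm_divide norm_mult)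
  also have "\<dots> \<le> e / (norm C * norm P)" using N0[of N "N + M"] N(1)
    by (intro divide_right_mono) auto
  also have "\<dots> = \<delta> / 8 / norm P" using assms(1) by (simp add: e_def)
  also have "\<dots> \<le> \<delta> / 8 * real N"
  proof -
    have "exp (- 1 * ln (real N)) \<le> norm P" unfolding P_def
      using mult_right_mono[OF re, of "ln (real N)"] N(3) by simp
    moreover have "exp (- 1 * ln (real N)) = 1 / real N" using N(3) by (simp add: exp_minus field_simps)
    ultimately have "1 / real N \<le> norm P" by simp
    then have "1 / norm P \<le> real N" using N(3) by (simp add: P_def field_simps)
    then have "\<delta> / 8 * (1 / norm P) \<le> \<delta> / 8 * real N" using \<delta>0 by (intro mult_left_mono) auto
    then show ?thesis by simp
  qed
  finally show False using M(2) dN by simp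
qed

lemma summable_exp_growth:
  fixes A \<rho> B :: real
  assumes "A < 0 \<or> A = 0 \<and> (B < 0 \<or> B = 0 \<and> \<rho> < -1)"
  shows "summable (\<lambda>n. exp (A * (real n * ln (real n)) + B * real n + \<rho> * ln (real n)))" (is "summable ?e")
proof (cases "A = 0 \<and> B = 0")
  case True
  then have "summable (\<lambda>n. real n powr \<rho>)" using assms by (simp add: summable_real_powr_iff)
  moreover have "\<forall>\<^sub>F n in sequentially. real n powr \<rho> = ?e n"
    using eventually_gt_at_top[of 0] by eventually_elim (use True in \<open>simp add: powr_def\<close>)
  ultimately show ?thesis by (rule iffD1[OF summable_cong, rotated])
next
  case False
  have "?e \<in> O(\<lambda>n. 1 / real n ^ 2)"
  proof (cases "A = 0")
    case True
    then have "B < 0" using False assms by auto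
    then show ?thesis unfolding True by simp real_asymp
  next
    case False
    then have "A < 0" using assms by auto
    then show ?thesis by real_asymp
  qed
  moreover have "summable (\<lambda>n. norm (1 / real n ^ 2))"
    using inverse_power_summable[of 2, where 'a = real] by (simp add: inverse_eq_divide)
  ultimately show ?thesis by (rule summable_comparison_test_bigo[rotated])
qed

text \<open>
  If one sequence of a growth class has a convergent series, then either the growth class decays
  faster than every power, or it is a pure power whose exponent has real part below -1, by
  \<open>not_summable_power_growth\<close>. In both cases all sequences of the same absolute growth are
  absolutely summable.
\<close>

lemma Stirling_growth_summable_transfer:
  assumes f: "Stirling_growth f A \<kappa> B" and g: "Stirling_growth g A \<kappa>' B" and re: "Re \<kappa>' = Re \<kappa>"
    and sum: "summable f"
  shows "summable (\<lambda>n. norm (g n))"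
proof -
  let ?e = "\<lambda>n. exp (A * (real n * ln (real n)) + B * real n + Re \<kappa> * ln (real n))"
  obtain c where c: "c > 0" "(\<lambda>n. norm (f n) / ?e n) \<longlonglongrightarrow> c"
    using Stirling_growth_norm_limit[OF f] by blast
  have "(\<lambda>n. norm (f n)) \<longlonglongrightarrow> 0" using summable_LIMSEQ_zero[OF sum] tendsto_norm_zero by blast
  from tendsto_divide[OF this c(2)] c(1)
  have e0: "?e \<longlonglongrightarrow> 0"
    by (simp, elim Lim_transform_eventually) 
       (use order_tendstoD(1)[OF c(2) c(1)] in \<open>eventually_elim, auto\<close>)
  have "A < 0 \<or> A = 0 \<and> (B < 0 \<or> B = 0 \<and> Re \<kappa> < -1)"
  proof (rule ccontr)
    assume neg: "\<not> ?thesis"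
    have no: "\<not> filterlim ?e at_top sequentially"
      using e0 by (metis not_tendsto_and_filterlim_at_infinity filterlim_at_top_imp_at_infinity sequentially_bot)
    consider "A > 0" | "A = 0" "B > 0" | "A = 0" "B = 0" "Re \<kappa> \<ge> -1" using neg by force
    then show False
    proof cases
      case 1
      then have "filterlim ?e at_top sequentially" by real_asymp
      with no show False ..
    next
      case 2
      then have "filterlim (\<lambda>n. exp (B * real n + Re \<kappa> * ln (real n))) at_top sequentially" by real_asymp
      with no 2 show False by simp
    next
      case 3
      then show False
        using f not_summable_power_growth[of _ f \<kappa>] sum unfolding Stirling_growth_def by auto
    qed
  qed
  then have "summable ?e" by (rule summable_exp_growth)
  obtain d where d: "d > 0" "(\<lambda>n. norm (g n) / ?e n) \<longlonglongrightarrow> d"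
    using Stirling_growth_norm_limit[OF g] unfolding re by blast
  have "\<forall>\<^sub>F n in sequentially. norm (norm (g n)) \<le> (d + 1) * ?e n"
    using order_tendstoD(2)[OF d(2), of "d + 1"] by (auto elim!: eventually_mono simp: divide_less_eq)
  then show ?thesis
    by (rule summable_comparison_test_ev) (intro summable_mult \<open>summable ?e\<close>)
qed

section \<open>The Beta integral with complex parameters\<close>

text \<open>
  The integrand of Euler's integral, extended by 0 to the whole line so that convolutions can be
  formed.
\<close>

definition Gamma_kernel :: "complex \<Rightarrow> real \<Rightarrow> complex" where
  "Gamma_kernel a s = indicator {0<..} s *\<^sub>R (of_real s powr (a - 1) / of_real (exp s))"

lemma borel_measurable_Gamma_kernel [measurable]: "Gamma_kernel a \<in> borel_measurable borel"
  unfolding Gamma_kernel_def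
  by (intro borel_measurable_continuous_on_indicator continuous_intros) auto

lemma integrable_Gamma_kernel:
  assumes "Re a > 0"
  shows "integrable lborel (Gamma_kernel a)"
proof -
  have "integrable lebesgue (Gamma_kernel a)"
    using absolutely_integrable_Gamma_integral'[OF assms]
    by (simp add: set_integrable_def Gamma_kernel_def[abs_def])
  then show ?thesis by (subst (asm) integrable_completion) auto
qed

lemma integral_Gamma_kernel:
  assumes "Re a > 0"
  shows "(\<integral>s. Gamma_kernel a s \<partial>lborel) = Gamma a"
proof -
  have "set_integrable lborel {0<..} (\<lambda>s. complex_of_real s powr (a - 1) / of_real (exp s))"
    using integrable_Gamma_kernel[OF assms] by (simp add: set_integrable_def Gamma_kernel_def[abs_def])
  from set_borel_integral_eq_integral(2)[OF this] show ?thesis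
    using integral_unique[OF Gamma_integral_complex'[OF assms]]
    by (simp add: set_lebesgue_integral_def Gamma_kernel_def)
qed

lemma norm_Beta_kernel:
  "v \<in> {0<..<1} \<Longrightarrow> norm (complex_of_real v powr (a - 1) * of_real (1 - v) powr (b - 1)) =
    v powr (Re a - 1) * (1 - v) powr (Re b - 1)"
  by (subst norm_mult, subst (1 2) norm_powr_real_powr) auto

lemma set_integrable_Beta_complex:
  assumes "Re a > 0" "Re b > 0"
  shows "set_integrable lborel {0<..<1} (\<lambda>v. complex_of_real v powr (a - 1) * of_real (1 - v) powr (b - 1))"
  unfolding set_integrable_def
proof (rule Bochner_Integration.integrable_bound[OF _ _ AE_I2])
  have "set_integrable lborel {0<..<1} (\<lambda>v. v powr (Re a - 1) * (1 - v) powr (Re b - 1))"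
    by (rule set_integrable_subset[OF integrable_Beta[OF assms]]) auto
  then show "integrable lborel (\<lambda>v. indicator {0<..<1} v *\<^sub>R (v powr (Re a - 1) * (1 - v) powr (Re b - 1)))"
    unfolding set_integrable_def .
  show "(\<lambda>v. indicator {0<..<1} v *\<^sub>R (complex_of_real v powr (a - 1) * of_real (1 - v) powr (b - 1)))
      \<in> borel_measurable lborel"
    unfolding measurable_lborel2
    by (intro borel_measurable_continuous_on_indicator continuous_intros) (auto simp: complex_eq_iff)
  show "norm (indicator {0<..<1} v *\<^sub>R (complex_of_real v powr (a - 1) * of_real (1 - v) powr (b - 1)))
     \<le> norm (indicator {0<..<1} v *\<^sub>R (v powr (Re a - 1) * (1 - v) powr (Re b - 1)))" for v :: real
    using norm_Beta_kernel[of v a b] by (simp add: indicator_def)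
qed

text \<open>
  The convolution of two Gamma kernels is the Beta integral \<open>F\<close> times the Gamma kernel of the sum of
  the parameters. Integrating this identity over the line gives
  \<open>F * Gamma (a + b) = Gamma a * Gamma b\<close>.
\<close>

lemma integral_Beta_complex:
  assumes a: "Re a > 0" and b: "Re b > 0"
  shows "(LINT v:{0<..<1}|lborel. complex_of_real v powr (a - 1) * of_real (1 - v) powr (b - 1)) = Beta a b"
proof -
  let ?k = "\<lambda>v. complex_of_real v powr (a - 1) * of_real (1 - v) powr (b - 1)"
  define F where "F = (LINT v:{0<..<1}|lborel. ?k v)"
  have shift: "integrable lborel (\<lambda>u. Gamma_kernel b (u - s))"
    "(\<integral>u. Gamma_kernel b (u - s) \<partial>lborel) = Gamma b"
    "(\<integral>u. norm (Gamma_kernel b (u - s)) \<partial>lborel) = (\<integral>u. norm (Gamma_kernel b u) \<partial>lborel)" for s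
    using lborel_integrable_real_affine[OF integrable_Gamma_kernel[OF b], of 1 "-s"]
      lborel_integral_real_affine[of 1 "Gamma_kernel b" "-s"] integral_Gamma_kernel[OF b]
      lborel_integral_real_affine[of 1 "\<lambda>u. norm (Gamma_kernel b u)" "-s"]
    by (simp_all add: add.commute)
  have int: "integrable (lborel \<Otimes>\<^sub>M lborel) (\<lambda>(s, u). Gamma_kernel a s * Gamma_kernel b (u - s))"
  proof (rule lborel_pair.Fubini_integrable)
    show "(\<lambda>(s, u). Gamma_kernel a s * Gamma_kernel b (u - s)) \<in> borel_measurable (lborel \<Otimes>\<^sub>M lborel)"
      by measurable
    show "integrable lborel (\<lambda>s. \<integral>u. norm (case (s, u) of (s, u) \<Rightarrow> Gamma_kernel a s * Gamma_kernel b (u - s)) \<partial>lborel)"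
      using integrable_norm[OF integrable_Gamma_kernel[OF a]] by (simp add: norm_mult shift)
    show "AE s in lborel. integrable lborel (\<lambda>u. case (s, u) of (s, u) \<Rightarrow> Gamma_kernel a s * Gamma_kernel b (u - s))"
      by (simp add: shift)
  qed
  have inner: "(\<integral>s. Gamma_kernel a s * Gamma_kernel b (u - s) \<partial>lborel) = F * Gamma_kernel (a + b) u" for u
  proof (cases "u > 0")
    case False
    then have "Gamma_kernel a s * Gamma_kernel b (u - s) = 0" for s
      by (auto simp: Gamma_kernel_def indicator_def)
    moreover have "Gamma_kernel (a + b) u = 0" using False by (simp add: Gamma_kernel_def)
    ultimately show ?thesis by (simp only: Bochner_Integration.integral_zero mult_zero_right)
  next
    case u: True
    have eq: "Gamma_kernel a (u * v) * Gamma_kernel b (u - u * v) =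
        (of_real u powr (a + b - 2) / of_real (exp u)) * (indicator {0<..<1} v *\<^sub>R ?k v)" for v
    proof (cases "v \<in> {0<..<1}")
      case True
      then have "complex_of_real (u * v) powr (a - 1) = of_real u powr (a - 1) * of_real v powr (a - 1)"
        using u by (simp add: powr_times_real)
      moreover have "complex_of_real (u * (1 - v)) powr (b - 1) = of_real u powr (b - 1) * of_real (1 - v) powr (b - 1)"
        unfolding of_real_mult using u True by (intro powr_times_real) auto
      moreover have "complex_of_real (exp (u * v)) * of_real (exp (u * (1 - v))) = of_real (exp u)"
        unfolding of_real_mult[symmetric] exp_add[symmetric] by (simp add: algebra_simps)
      moreover have "complex_of_real u powr (a - 1) * of_real u powr (b - 1) = of_real u powr (a + b - 2)"
        unfolding powr_add[symmetric] by (simp add: algebra_simps)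
      moreover have "u - u * v = u * (1 - v)" "u * v > 0" "u * (1 - v) > 0"
        using u True by (auto simp: algebra_simps)
      ultimately show ?thesis using True
        by (simp add: Gamma_kernel_def)
    next
      case False
      then have "\<not> (u * v > 0 \<and> u - u * v > 0)"
        using u by (auto simp: zero_less_mult_iff)
      then show ?thesis using False by (auto simp: Gamma_kernel_def indicator_def)
    qed
    have "(\<integral>s. Gamma_kernel a s * Gamma_kernel b (u - s) \<partial>lborel) =
        of_real u * (\<integral>v. Gamma_kernel a (u * v) * Gamma_kernel b (u - u * v) \<partial>lborel)"
      using lborel_integral_real_affine[of u "\<lambda>s. Gamma_kernel a s * Gamma_kernel b (u - s)" 0] u
      by (simp add: scaleR_conv_of_real)
    also have "\<dots> = of_real u * ((of_real u powr (a + b - 2) / of_real (exp u)) * F)"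
      unfolding eq F_def set_lebesgue_integral_def by (simp only: integral_mult_right_zero)
    also have "\<dots> = F * ((of_real u powr 1 * of_real u powr (a + b - 2)) / of_real (exp u))"
      using u by simp
    also have "complex_of_real u powr 1 * of_real u powr (a + b - 2) = of_real u powr (a + b - 1)"
      unfolding powr_add[symmetric] by simp
    finally show ?thesis using u by (simp add: Gamma_kernel_def)
  qed
  have "F * Gamma (a + b) = (\<integral>u. F * Gamma_kernel (a + b) u \<partial>lborel)"
    using a b by (simp add: integral_Gamma_kernel)
  also have "\<dots> = (\<integral>u. (\<integral>s. Gamma_kernel a s * Gamma_kernel b (u - s) \<partial>lborel) \<partial>lborel)"
    by (simp only: inner)
  also have "\<dots> = (\<integral>s. (\<integral>u. Gamma_kernel a s * Gamma_kernel b (u - s) \<partial>lborel) \<partial>lborel)"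
    by (rule lborel_pair.Fubini_integral[OF int])
  also have "\<dots> = Gamma a * Gamma b"
    using a by (simp add: shift integral_Gamma_kernel)
  finally have "F * Gamma (a + b) = Gamma a * Gamma b" .
  moreover have "Gamma (a + b) \<noteq> 0"
    using a b not_nonpos_Int_of_Re_pos[of "a + b"] by (simp add: Gamma_eq_zero_iff)
  ultimately show ?thesis unfolding F_def[symmetric] Beta_def by (simp add: field_simps)
qed

lemma integral_norm_Beta_complex:
  assumes "Re a > 0" "Re b > 0"
  shows "(LINT v:{0<..<1}|lborel. norm (complex_of_real v powr (a - 1) * of_real (1 - v) powr (b - 1))) =
    Beta (Re a) (Re b)"
proof -
  have "set_integrable lborel {0<..<1} (\<lambda>v. v powr (Re a - 1) * (1 - v) powr (Re b - 1))"
    by (rule set_integrable_subset[OF integrable_Beta[OF assms]]) auto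
  moreover have "((\<lambda>v. v powr (Re a - 1) * (1 - v) powr (Re b - 1)) has_integral Beta (Re a) (Re b)) {0<..<1}"
    using has_integral_Beta_real[OF assms] by (simp add: has_integral_Icc_iff_Ioo)
  ultimately have "(LINT v:{0<..<1}|lborel. v powr (Re a - 1) * (1 - v) powr (Re b - 1)) = Beta (Re a) (Re b)"
    using set_borel_integral_eq_integral(2) integral_unique by metis
  moreover have "(LINT v:{0<..<1}|lborel. norm (complex_of_real v powr (a - 1) * of_real (1 - v) powr (b - 1))) =
      (LINT v:{0<..<1}|lborel. v powr (Re a - 1) * (1 - v) powr (Re b - 1))"
    by (intro set_lebesgue_integral_cong allI impI norm_Beta_kernel) auto
  ultimately show ?thesis by simp
qed

lemma norm_Beta_le:
  assumes "Re a > 0" "Re b > 0"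
  shows "norm (Beta a b) \<le> Beta (Re a) (Re b)"
  unfolding integral_Beta_complex[OF assms, symmetric] integral_norm_Beta_complex[OF assms, symmetric]
  by (rule set_integral_norm_bound[OF set_integrable_Beta_complex[OF assms]])

text \<open>
  Up to phase this is the integrand of the fractional integral for a single power of \<open>t\<close>; the
  parameters are chosen such that \<open>t = y v\<^bsup>1/\<eta>\<^esup>\<close> turns it into the Beta integrand of \<open>p\<close> and \<open>\<alpha>\<close>.
\<close>

definition power_kernel :: "real \<Rightarrow> complex \<Rightarrow> complex \<Rightarrow> real \<Rightarrow> real \<Rightarrow> complex" where
  "power_kernel \<eta> p \<alpha> y t = of_real t powr (of_real \<eta> * p - 1) * of_real (y powr \<eta> - t powr \<eta>) powr (\<alpha> - 1)"

lemma norm_power_kernel: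
  assumes "\<eta> > 0" "0 < t" "t < y"
  shows "norm (power_kernel \<eta> p \<alpha> y t) = t powr (\<eta> * Re p - 1) * (y powr \<eta> - t powr \<eta>) powr (Re \<alpha> - 1)"
proof -
  have "t powr \<eta> \<le> y powr \<eta>" using assms by (intro powr_mono2) auto
  then show ?thesis unfolding power_kernel_def using assms
    by (subst norm_mult, subst (1 2) norm_powr_real_powr) auto
qed

lemma power_kernel_of_real:
  assumes "\<eta> > 0" "0 < t" "t < y"
  shows "power_kernel \<eta> (of_real p) (of_real \<alpha>) y t =
    of_real (t powr (\<eta> * p - 1) * (y powr \<eta> - t powr \<eta>) powr (\<alpha> - 1))"
proof -
  have "t powr \<eta> \<le> y powr \<eta>" using assms by (intro powr_mono2) auto
  then have "complex_of_real (t powr (\<eta> * p - 1)) = of_real t powr of_real (\<eta> * p - 1)"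
    "complex_of_real ((y powr \<eta> - t powr \<eta>) powr (\<alpha> - 1)) = of_real (y powr \<eta> - t powr \<eta>) powr of_real (\<alpha> - 1)"
    using assms by (auto simp only: powr_of_real)
  then show ?thesis unfolding power_kernel_def by (simp only: of_real_mult of_real_diff of_real_1)
qed

lemma continuous_on_power_kernel:
  assumes "\<eta> > 0"
  shows "continuous_on {0<..<y} (power_kernel \<eta> p \<alpha> y)"
proof -
  have "t powr \<eta> < y powr \<eta>" if "t \<in> {0<..<y}" for t
    using that assms by (intro powr_less_mono2) auto
  then show ?thesis unfolding power_kernel_def
    by (intro continuous_intros) (force simp: complex_eq_iff)+
qed

lemma power_kernel_substitution:
  assumes "\<eta> > 0" "y > 0" "0 < v" "v < 1"
  shows "of_real (y / \<eta> * v powr (1 / \<eta> - 1)) * power_kernel \<eta> p \<alpha> y (y * v powr (1 / \<eta>)) =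
    of_real y powr (of_real \<eta> * (p + \<alpha> - 1)) / of_real \<eta> *
    (of_real v powr (p - 1) * of_real (1 - v) powr (\<alpha> - 1))"
proof -
  define E a b c where "E = complex_of_real \<eta>" and "a = complex_of_real (ln y)"
    and "b = complex_of_real (ln v)" and "c = complex_of_real (ln (1 - v))"
  have E: "E \<noteq> 0" using assms by (simp add: E_def)
  have P: "complex_of_real r powr z = exp (z * of_real (ln r))" if "r > 0" for r z
    using that by (simp add: powr_def Ln_of_real)
  have "(y * v powr (1 / \<eta>)) powr \<eta> = y powr \<eta> * v"
    using assms by (simp add: powr_mult powr_powr)
  then have e: "y powr \<eta> - (y * v powr (1 / \<eta>)) powr \<eta> = y powr \<eta> * (1 - v)"
    by (simp add: algebra_simps)
  have l1: "complex_of_real (ln (y * v powr (1 / \<eta>))) = a + b / E"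
    using assms by (simp add: ln_mult ln_powr E_def a_def b_def)
  have l2: "complex_of_real (ln (y powr \<eta> * (1 - v))) = E * a + c"
    using assms by (simp add: ln_mult ln_powr E_def a_def c_def)
  have "y * v powr (1 / \<eta> - 1) = exp (ln y + (1 / \<eta> - 1) * ln v)"
    using assms by (simp add: exp_add powr_def)
  then have "complex_of_real (y * v powr (1 / \<eta> - 1)) = exp (of_real (ln y + (1 / \<eta> - 1) * ln v))"
    by (simp only: exp_of_real)
  then have f: "complex_of_real (y / \<eta> * v powr (1 / \<eta> - 1)) = exp (a + (1 / E - 1) * b) / E"
    by (simp add: E_def a_def b_def)
  have p: "y * v powr (1 / \<eta>) > 0" "y powr \<eta> * (1 - v) > 0" "1 - v > 0" using assms by auto
  have "exp (a + (1 / E - 1) * b) * (exp ((E * p - 1) * (a + b / E)) * exp ((\<alpha> - 1) * (E * a + c))) =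
        exp (E * (p + \<alpha> - 1) * a) * (exp ((p - 1) * b) * exp ((\<alpha> - 1) * c))"
    unfolding exp_add[symmetric]
    by (rule arg_cong[of _ _ exp]) (use E in \<open>simp add: field_simps\<close>)
  then show ?thesis
    unfolding power_kernel_def e f P[OF p(1)] P[OF p(2)] P[OF p(3)] P[OF assms(2)] P[OF assms(3)] l1 l2
    by (simp add: E_def a_def b_def c_def)
qed

lemma set_integrable_cong_on:
  assumes "set_integrable M A f" "\<And>x. x \<in> A \<Longrightarrow> f x = g x"
  shows "set_integrable M A g"
  using set_integrable_cong[of M M A A f g] assms by auto

text \<open>
  The substitution theorem for complex integrands presupposes integrability of both sides. The
  nonnegative version, applied to the norm, supplies it from the integrability of the Beta integrand.
\<close>

lemma power_kernel_integral:
  assumes \<eta>: "\<eta> > 0" and y: "y > 0" and p: "Re p > 0" and \<alpha>: "Re \<alpha> > 0"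
  shows "set_integrable lborel {0<..<y} (power_kernel \<eta> p \<alpha> y)"
    and "(LINT t:{0<..<y}|lborel. power_kernel \<eta> p \<alpha> y t) =
      of_real y powr (of_real \<eta> * (p + \<alpha> - 1)) / of_real \<eta> * Beta p \<alpha>"
proof -
  define g where "g = (\<lambda>v. y * v powr (1 / \<eta>))"
  define g' where "g' = (\<lambda>v. y / \<eta> * v powr (1 / \<eta> - 1))"
  define N where "N = (\<lambda>t. norm (power_kernel \<eta> p \<alpha> y t))"
  have g: "0 < g v" "g v < y" if "0 < v" "v < 1" for v
    using that y \<eta> powr_less_mono2[of "1 / \<eta>" v 1] by (auto simp: g_def)
  have deriv: "DERIV g v :> g' v" if "0 < v" for v
    unfolding g_def g'_def using that by (auto intro!: derivative_eq_intros)
  have cont: "isCont (power_kernel \<eta> p \<alpha> y) (g v)" if "0 < v" "v < 1" for v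
    using continuous_on_power_kernel[OF \<eta>, of y p \<alpha>] g[OF that]
    by (simp add: continuous_on_eq_continuous_at)
  have cont': "isCont g' v" if "0 < v" for v
    unfolding g'_def using that by (intro continuous_intros) auto
  have limA: "((ereal \<circ> g \<circ> real_of_ereal) \<longlongrightarrow> ereal 0) (at_right (ereal 0))"
  proof -
    have "(g \<longlongrightarrow> y * 0 powr (1 / \<eta>)) (at_right 0)" unfolding g_def
      using \<eta> by (intro tendsto_intros tendsto_powr') (auto simp: eventually_at_filter)
    then show ?thesis unfolding ereal_tendsto_simps by simp
  qed
  have limB: "((ereal \<circ> g \<circ> real_of_ereal) \<longlongrightarrow> ereal y) (at_left (ereal 1))"
  proof -
    have "(g \<longlongrightarrow> y * 1 powr (1 / \<eta>)) (at_left 1)" unfolding g_def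
      by (intro tendsto_intros) auto
    then show ?thesis unfolding ereal_tendsto_simps by simp
  qed
  define c where "c = complex_of_real y powr (of_real \<eta> * (p + \<alpha> - 1)) / of_real \<eta>"
  have sub: "g' v *\<^sub>R power_kernel \<eta> p \<alpha> y (g v) = c * (of_real v powr (p - 1) * of_real (1 - v) powr (\<alpha> - 1))"
    if "v \<in> {0<..<1}" for v
    using power_kernel_substitution[OF \<eta> y, of v p \<alpha>] that
    by (simp add: g_def g'_def c_def scaleR_conv_of_real)
  have int: "set_integrable lborel {0<..<1} (\<lambda>v. g' v *\<^sub>R power_kernel \<eta> p \<alpha> y (g v))"
    by (rule set_integrable_cong_on[OF set_integrable_mult_right[OF set_integrable_Beta_complex[OF p \<alpha>]]])
       (simp add: sub)
  have int': "set_integrable lborel {0<..<1} (\<lambda>v. N (g v) * g' v)"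
    by (rule set_integrable_cong_on[OF set_integrable_norm[OF int]]) (use y \<eta> in \<open>simp add: N_def g'_def\<close>)
  have "set_integrable lborel (einterval (ereal 0) (ereal y)) N"
  proof (rule interval_integral_substitution_nonneg(1)[where a = "ereal 0" and b = "ereal 1" and g = g and g' = g'])
    show "set_integrable lborel (einterval (ereal 0) (ereal 1)) (\<lambda>v. N (g v) * g' v)"
      unfolding einterval_eq by (rule int')
    show "DERIV g v :> g' v" "isCont N (g v)" "isCont g' v" "0 \<le> N (g v)"
      if "ereal 0 < ereal v" "ereal v < ereal 1" for v
      using deriv[of v] cont[of v] cont'[of v] that unfolding N_def by (auto intro: isCont_norm)
    show "0 \<le> g' v" if "ereal 0 \<le> ereal v" for v using y \<eta> by (simp add: g'_def)
  qed (use limA limB in auto)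
  then have N: "set_integrable lborel {0<..<y} N" unfolding einterval_eq .
  show 1: "set_integrable lborel {0<..<y} (power_kernel \<eta> p \<alpha> y)"
    unfolding set_integrable_def
  proof (rule Bochner_Integration.integrable_bound[OF N[unfolded set_integrable_def] _ AE_I2])
    show "(\<lambda>t. indicator {0<..<y} t *\<^sub>R power_kernel \<eta> p \<alpha> y t) \<in> borel_measurable lborel"
      unfolding measurable_lborel2
      by (intro borel_measurable_continuous_on_indicator continuous_on_power_kernel \<eta>) auto
  qed (simp add: N_def)
  have "(LINT t:{0<..<y}|lborel. power_kernel \<eta> p \<alpha> y t) =
      (LINT v:{0<..<1}|lborel. g' v *\<^sub>R power_kernel \<eta> p \<alpha> y (g v))"
  proof -
    have "(LBINT t=ereal 0..ereal y. power_kernel \<eta> p \<alpha> y t) =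
      (LBINT v=ereal 0..ereal 1. g' v *\<^sub>R power_kernel \<eta> p \<alpha> y (g v))"
    proof (rule interval_integral_substitution_integrable)
      show "DERIV g v :> g' v" "isCont (power_kernel \<eta> p \<alpha> y) (g v)" "isCont g' v"
        if "ereal 0 < ereal v" "ereal v < ereal 1" for v
        using deriv[of v] cont[of v] cont'[of v] that by auto
      show "0 \<le> g' v" if "ereal 0 \<le> ereal v" for v using y \<eta> by (simp add: g'_def)
      show "set_integrable lborel (einterval (ereal 0) (ereal 1)) (\<lambda>v. g' v *\<^sub>R power_kernel \<eta> p \<alpha> y (g v))"
        unfolding einterval_eq by (rule int)
      show "set_integrable lborel (einterval (ereal 0) (ereal y)) (power_kernel \<eta> p \<alpha> y)"
        unfolding einterval_eq by (rule 1)
    qed (use limA limB in auto)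
    then show ?thesis using y by (simp add: interval_lebesgue_integral_def)
  qed
  also have "\<dots> = (LINT v:{0<..<1}|lborel. c * (of_real v powr (p - 1) * of_real (1 - v) powr (\<alpha> - 1)))"
    by (intro set_lebesgue_integral_cong) (auto simp: sub)
  also have "\<dots> = c * (LINT v:{0<..<1}|lborel. of_real v powr (p - 1) * of_real (1 - v) powr (\<alpha> - 1))"
    by (rule set_integral_mult_right)
  also have "\<dots> = c * Beta p \<alpha>" unfolding integral_Beta_complex[OF p \<alpha>] ..
  finally show "(LINT t:{0<..<y}|lborel. power_kernel \<eta> p \<alpha> y t) =
      of_real y powr (of_real \<eta> * (p + \<alpha> - 1)) / of_real \<eta> * Beta p \<alpha>" unfolding c_def .
qed

text \<open>The norm of the kernel is the kernel for the real parts of the parameters.\<close>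

lemma norm_power_kernel_integral:
  assumes \<eta>: "\<eta> > 0" and y: "y > 0" and p: "Re p > 0" and \<alpha>: "Re \<alpha> > 0"
  shows "(LINT t:{0<..<y}|lborel. norm (power_kernel \<eta> p \<alpha> y t)) =
      y powr (\<eta> * (Re p + Re \<alpha> - 1)) / \<eta> * Beta (Re p) (Re \<alpha>)"
proof -
  have "complex_of_real (LINT t:{0<..<y}|lborel. norm (power_kernel \<eta> p \<alpha> y t)) =
      (LINT t:{0<..<y}|lborel. of_real (norm (power_kernel \<eta> p \<alpha> y t)))"
    by (rule set_integral_complex_of_real[symmetric])
  also have "\<dots> = (LINT t:{0<..<y}|lborel. power_kernel \<eta> (of_real (Re p)) (of_real (Re \<alpha>)) y t)"
    by (intro set_lebesgue_integral_cong) (use \<eta> in \<open>auto simp: norm_power_kernel power_kernel_of_real\<close>)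
  also have "\<dots> = of_real y powr (of_real \<eta> * (of_real (Re p) + of_real (Re \<alpha>) - 1)) / of_real \<eta> *
      Beta (of_real (Re p)) (of_real (Re \<alpha>))"
    using assms by (intro power_kernel_integral) auto
  also have "\<dots> = of_real (y powr (\<eta> * (Re p + Re \<alpha> - 1)) / \<eta> * Beta (Re p) (Re \<alpha>))"
  proof -
    have "complex_of_real (y powr (\<eta> * (Re p + Re \<alpha> - 1))) = of_real y powr of_real (\<eta> * (Re p + Re \<alpha> - 1))"
      using y by (simp only: powr_of_real)
    then show ?thesis by (simp add: Beta_complex_of_real)
  qed
  finally show ?thesis by (simp only: of_real_eq_iff)
qed

section \<open>The fractional derivative of a power series\<close>

lemma powser_summable_norm:
  fixes e :: "nat \<Rightarrow> complex"
  assumes "\<And>s. norm s < R \<Longrightarrow> summable (\<lambda>n. e n * s ^ n)" "0 \<le> r" "r < R"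
  shows "summable (\<lambda>n. norm (e n) * r ^ n)"
proof -
  obtain r' where r': "r < r'" "r' < R" using dense[OF assms(3)] by blast
  have "summable (\<lambda>n. norm (e n * of_real r ^ n))"
    by (rule powser_insidea[where x = "of_real r'"]) (use assms r' in auto)
  then show ?thesis using assms(2) by (simp add: norm_mult norm_power)
qed

lemma of_real_powr_progression:
  assumes "y > 0"
  shows "complex_of_real y powr (z + of_real (\<nu> * real n)) = of_real y powr z * of_real (y powr \<nu>) ^ n"
proof -
  have "complex_of_real (y powr \<nu>) ^ n = of_real ((y powr \<nu>) powr real n)"
    using assms by (simp add: powr_realpow)
  also have "\<dots> = of_real y powr of_real (\<nu> * real n)"
    unfolding powr_powr using assms by (intro powr_of_real[symmetric]) auto
  finally show ?thesis by (simp add: powr_add)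
qed

lemma of_real_minus_powr:
  assumes "a > 0"
  shows "complex_of_real (- a) powr w = exp (\<i> * of_real pi * w) * of_real a powr w"
proof -
  have "Ln (complex_of_real (- a)) = of_real (ln a) + \<i> * of_real pi"
    using assms Ln_minus[of "complex_of_real a"] by (simp add: Ln_of_real mult.commute)
  then show ?thesis using assms
    by (simp add: powr_def exp_add[symmetric] algebra_simps Ln_of_real)
qed

lemma Re_frac_order_minus: "Re (of_nat (frac_order \<sigma>) - \<sigma>) > 0"
  unfolding frac_order_def by simp linarith

lemma power_kernel_progression:
  assumes "\<eta> > 0" "t > 0"
  shows "power_kernel \<eta> ((\<mu> + of_real (\<nu> * real n)) / of_real \<eta> + 1) \<alpha> y t =
    power_kernel \<eta> (\<mu> / of_real \<eta> + 1) \<alpha> y t * of_real (t powr \<nu>) ^ n"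
proof -
  have "complex_of_real \<eta> * ((\<mu> + of_real (\<nu> * real n)) / of_real \<eta> + 1) - 1 =
     (of_real \<eta> * (\<mu> / of_real \<eta> + 1) - 1) + of_real (\<nu> * real n)"
    using assms by (simp add: field_simps)
  then show ?thesis unfolding power_kernel_def
    by (simp only: of_real_powr_progression[OF assms(2)] mult_ac)
qed

text \<open>
  For \<open>t < y\<close> the base \<open>t\<^sup>\<eta> - y\<^sup>\<eta>\<close> is negative, and the principal branch produces the exponential
  phase factor.
\<close>

lemma frac_integrand_power:
  fixes \<sigma> \<mu> S :: complex
  assumes "\<eta> > 0" "0 < t" "t < y" and f: "f t = of_real t powr \<mu> * S"
  defines "\<alpha> \<equiv> of_nat (frac_order \<sigma>) - \<sigma>"
  shows "frac_integrand \<eta> \<sigma> f y t =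
    exp (\<i> * of_real pi * (\<alpha> - 1)) * power_kernel \<eta> (\<mu> / of_real \<eta> + 1) \<alpha> y t * S"
proof -
  define a where "a = y powr \<eta> - t powr \<eta>"
  have "t powr \<eta> < y powr \<eta>" using assms by (intro powr_less_mono2) auto
  then have a: "a > 0" by (simp add: a_def)
  define w where "w = \<sigma> - of_nat (frac_order \<sigma>) + 1"
  have w: "- w = \<alpha> - 1" by (simp add: w_def \<alpha>_def)
  have "t powr \<eta> - y powr \<eta> = - a" by (simp add: a_def)
  then have "frac_integrand \<eta> \<sigma> f y t =
      of_real (t powr (\<eta> - 1)) * (of_real t powr \<mu> * S) / (exp (\<i> * of_real pi * w) * of_real a powr w)"
    unfolding frac_integrand_def f w_def[symmetric] by (simp only: of_real_minus_powr[OF a])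
  also have "\<dots> = (of_real (t powr (\<eta> - 1)) * of_real t powr \<mu>) * S * exp (- (\<i> * of_real pi * w)) * of_real a powr (- w)"
    by (simp add: exp_minus powr_minus field_simps)
  also have "complex_of_real (t powr (\<eta> - 1)) * of_real t powr \<mu> = of_real t powr (of_real \<eta> * (\<mu> / of_real \<eta> + 1) - 1)"
  proof -
    have "complex_of_real (t powr (\<eta> - 1)) = of_real t powr of_real (\<eta> - 1)"
      using assms by (simp only: powr_of_real)
    moreover have "of_real (\<eta> - 1) + \<mu> = of_real \<eta> * (\<mu> / of_real \<eta> + 1) - 1"
      using assms by (simp add: field_simps)
    ultimately show ?thesis by (simp only: powr_add[symmetric])
  qed
  also have "exp (- (\<i> * of_real pi * w)) = exp (\<i> * of_real pi * (\<alpha> - 1))" unfolding w[symmetric] by simp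
  finally show ?thesis unfolding power_kernel_def w a_def by (simp add: mult_ac)
qed

text \<open>
  \<open>Re (p n)\<close> increases with \<open>n\<close>, so the Beta factors are bounded by the one for \<open>n = 0\<close> and do not
  shrink the disc of convergence.
\<close>

lemma summable_times_Beta:
  fixes e :: "nat \<Rightarrow> complex"
  assumes "\<eta> > 0" "\<nu> > 0" "Re \<mu> > 0" "Re \<alpha> > 0"
    and e: "\<And>s. norm s < R \<Longrightarrow> summable (\<lambda>n. e n * s ^ n)" and r: "0 \<le> r" "r < R"
  defines "p \<equiv> \<lambda>n. (\<mu> + of_real (\<nu> * real n)) / of_real \<eta> + 1"
  shows "summable (\<lambda>n. norm (e n) * Beta (Re (p n)) (Re \<alpha>) * r ^ n)"
    and "summable (\<lambda>n. norm (e n * Beta (p n) \<alpha> * of_real r ^ n))"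
proof -
  have p0: "Re (p 0) > 0"
    unfolding p_def using assms by (auto simp: field_simps add_pos_pos)
  have p_mono: "Re (p n) \<ge> Re (p 0)" for n
    unfolding p_def using assms by (auto simp: field_simps)
  then have p: "Re (p n) > 0" for n using p0 less_le_trans by blast
  have B: "0 \<le> Beta (Re (p n)) (Re \<alpha>)" "Beta (Re (p n)) (Re \<alpha>) \<le> Beta (Re (p 0)) (Re \<alpha>)" for n
    using order_trans[OF norm_ge_zero norm_Beta_le[OF p[of n] assms(4)]] p0 p_mono[of n] assms(4)
    by (auto intro: Beta_real_mono)
  show 1: "summable (\<lambda>n. norm (e n) * Beta (Re (p n)) (Re \<alpha>) * r ^ n)"
  proof (rule summable_comparison_test')
    show "summable (\<lambda>n. Beta (Re (p 0)) (Re \<alpha>) * (norm (e n) * r ^ n))"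
      by (intro summable_mult powser_summable_norm[OF e r])
    show "norm (norm (e n) * Beta (Re (p n)) (Re \<alpha>) * r ^ n) \<le> Beta (Re (p 0)) (Re \<alpha>) * (norm (e n) * r ^ n)" for n
      using mult_right_mono[OF B(2)[of n], of "norm (e n) * r ^ n"] B(1)[of n] r
      by (simp add: abs_mult mult_ac)
  qed
  show "summable (\<lambda>n. norm (e n * Beta (p n) \<alpha> * of_real r ^ n))"
  proof (rule summable_comparison_test'[OF 1])
    show "norm (norm (e n * Beta (p n) \<alpha> * of_real r ^ n)) \<le> norm (e n) * Beta (Re (p n)) (Re \<alpha>) * r ^ n" for n
      using norm_Beta_le[of "p n" \<alpha>] p[of n] B(1)[of n] assms(4) r
      by (auto simp: norm_mult norm_power intro!: mult_mono)
  qed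
qed

text \<open>
  Termwise integration is justified by absolute convergence: the integrals of the norms are the
  summands of the first series in \<open>summable_times_Beta\<close>.
\<close>

lemma frac_integral_power_series:
  fixes e :: "nat \<Rightarrow> complex" and \<sigma> \<mu> :: complex
  assumes \<eta>: "\<eta> > 0" and \<nu>: "\<nu> > 0" and \<mu>: "Re \<mu> > 0" and y: "y > 0" "y powr \<nu> < R"
    and e: "\<And>s. norm s < R \<Longrightarrow> summable (\<lambda>n. e n * s ^ n)"
    and f: "\<And>t. 0 < t \<Longrightarrow> t < y \<Longrightarrow> f t = of_real t powr \<mu> * (\<Sum>n. e n * of_real (t powr \<nu>) ^ n)"
  defines "p \<equiv> \<lambda>n. (\<mu> + of_real (\<nu> * real n)) / of_real \<eta> + 1"
    and "\<alpha> \<equiv> of_nat (frac_order \<sigma>) - \<sigma>"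
  shows "frac_integral \<eta> \<sigma> f y = - (exp (\<i> * of_real pi * (\<alpha> - 1)) / of_real \<eta>) *
    (of_real y powr (\<mu> + of_real \<eta> * \<alpha>) * (\<Sum>n. e n * Beta (p n) \<alpha> * of_real (y powr \<nu>) ^ n))"
proof -
  define c where "c = exp (\<i> * of_real pi * (\<alpha> - 1))"
  define F where "F n t = indicator {0<..<y} t *\<^sub>R (c * e n * power_kernel \<eta> (p n) \<alpha> y t)" for n t
  have \<alpha>: "Re \<alpha> > 0" unfolding \<alpha>_def by (rule Re_frac_order_minus)
  have p: "Re (p n) > 0" for n
    unfolding p_def using \<eta> \<nu> \<mu> by (auto intro!: add_pos_pos add_nonneg_pos divide_nonneg_pos)
  have term_eq: "power_kernel \<eta> (p n) \<alpha> y t = power_kernel \<eta> (\<mu> / of_real \<eta> + 1) \<alpha> y t * of_real (t powr \<nu>) ^ n"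
    if "t > 0" for t n
    unfolding p_def by (rule power_kernel_progression[OF \<eta> that])
  have tR: "norm (complex_of_real (t powr \<nu>)) < R" "t powr \<nu> < R" if "0 < t" "t < y" for t
    using powr_less_mono2[of \<nu> t y] that \<nu> y by auto
  have F_sum: "(\<Sum>n. F n t) = indicator {0<..<y} t *\<^sub>R frac_integrand \<eta> \<sigma> f y t" for t
  proof (cases "t \<in> {0<..<y}")
    case True
    then have t: "0 < t" "t < y" by auto
    have "F n t = c * power_kernel \<eta> (\<mu> / of_real \<eta> + 1) \<alpha> y t * (e n * of_real (t powr \<nu>) ^ n)" for n
      using True by (simp add: F_def term_eq[OF t(1)])
    then have "(\<Sum>n. F n t) = c * power_kernel \<eta> (\<mu> / of_real \<eta> + 1) \<alpha> y t * (\<Sum>n. e n * of_real (t powr \<nu>) ^ n)"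
      using suminf_mult[OF e[OF tR(1)[OF t]]] by simp
    also have "\<dots> = frac_integrand \<eta> \<sigma> f y t"
      using frac_integrand_power[where f = f and \<sigma> = \<sigma>, OF \<eta> t f[OF t]] by (simp add: c_def \<alpha>_def)
    finally show ?thesis using True by simp
  qed (simp add: F_def)
  have int_F: "integrable lborel (F n)" for n
    using set_integrable_mult_right[OF power_kernel_integral(1)[OF \<eta> y(1) p[of n] \<alpha>], of "c * e n"]
    unfolding set_integrable_def F_def .
  have exponent: "complex_of_real y powr (of_real \<eta> * (p n + \<alpha> - 1)) =
      of_real y powr (\<mu> + of_real \<eta> * \<alpha>) * of_real (y powr \<nu>) ^ n" for n
  proof -
    have "of_real \<eta> * (p n + \<alpha> - 1) = (\<mu> + of_real \<eta> * \<alpha>) + of_real (\<nu> * real n)"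
      using \<eta> by (simp add: p_def field_simps)
    then show ?thesis by (simp only: of_real_powr_progression[OF y(1)])
  qed
  have F_int: "(\<integral>t. F n t \<partial>lborel) = c / of_real \<eta> * of_real y powr (\<mu> + of_real \<eta> * \<alpha>) *
      (e n * Beta (p n) \<alpha> * of_real (y powr \<nu>) ^ n)" for n
  proof -
    have "(\<integral>t. F n t \<partial>lborel) = (LINT t:{0<..<y}|lborel. c * e n * power_kernel \<eta> (p n) \<alpha> y t)"
      unfolding F_def set_lebesgue_integral_def ..
    also have "\<dots> = c * e n * (LINT t:{0<..<y}|lborel. power_kernel \<eta> (p n) \<alpha> y t)" by simp
    finally show ?thesis
      unfolding power_kernel_integral(2)[OF \<eta> y(1) p \<alpha>] exponent by (simp add: mult_ac)
  qed
  have norm_exponent: "y powr (\<eta> * (Re (p n) + Re \<alpha> - 1)) = y powr (Re \<mu> + \<eta> * Re \<alpha>) * (y powr \<nu>) ^ n" for n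
  proof -
    have "\<eta> * (Re (p n) + Re \<alpha> - 1) = (Re \<mu> + \<eta> * Re \<alpha>) + \<nu> * real n"
      using \<eta> by (simp add: p_def field_simps)
    then show ?thesis using y by (simp add: powr_add powr_powr[symmetric] powr_realpow)
  qed
  have F_norm: "(\<integral>t. norm (F n t) \<partial>lborel) = norm c / \<eta> * y powr (Re \<mu> + \<eta> * Re \<alpha>) *
      (norm (e n) * Beta (Re (p n)) (Re \<alpha>) * (y powr \<nu>) ^ n)" for n
  proof -
    have "(\<integral>t. norm (F n t) \<partial>lborel) = (LINT t:{0<..<y}|lborel. norm c * norm (e n) * norm (power_kernel \<eta> (p n) \<alpha> y t))"
      unfolding F_def set_lebesgue_integral_def by (simp add: norm_mult mult_ac)
    also have "\<dots> = norm c * norm (e n) * (LINT t:{0<..<y}|lborel. norm (power_kernel \<eta> (p n) \<alpha> y t))" by simp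
    finally show ?thesis
      unfolding norm_power_kernel_integral[OF \<eta> y(1) p \<alpha>] norm_exponent by (simp add: mult_ac)
  qed
  have "AE t in lborel. summable (\<lambda>n. norm (F n t))"
  proof (rule AE_I2)
    fix t :: real
    show "summable (\<lambda>n. norm (F n t))"
    proof (cases "t \<in> {0<..<y}")
      case True
      then have t: "0 < t" "t < y" by auto
      have "norm (F n t) = norm (c * power_kernel \<eta> (\<mu> / of_real \<eta> + 1) \<alpha> y t) * (norm (e n) * (t powr \<nu>) ^ n)" for n
        using True by (simp add: F_def term_eq[OF t(1)] norm_mult norm_power)
      then show ?thesis using powser_summable_norm[OF e _ tR(2)[OF t]]
        by (simp add: summable_mult)
    qed (simp add: F_def)
  qed
  moreover have "summable (\<lambda>n. \<integral>t. norm (F n t) \<partial>lborel)"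
    unfolding F_norm using summable_times_Beta(1)[OF \<eta> \<nu> \<mu> \<alpha> e _ y(2)] y
    by (intro summable_mult) (simp add: p_def)
  ultimately have "(\<integral>t. (\<Sum>n. F n t) \<partial>lborel) = (\<Sum>n. \<integral>t. F n t \<partial>lborel)"
    by (intro integral_suminf int_F)
  also have "\<dots> = c / of_real \<eta> * of_real y powr (\<mu> + of_real \<eta> * \<alpha>) *
      (\<Sum>n. e n * Beta (p n) \<alpha> * of_real (y powr \<nu>) ^ n)"
  proof -
    have "summable (\<lambda>n. norm (e n * Beta (p n) \<alpha> * of_real (y powr \<nu>) ^ n))"
      using summable_times_Beta(2)[OF \<eta> \<nu> \<mu> \<alpha> e _ y(2)] by (simp add: p_def)
    then show ?thesis unfolding F_int by (rule suminf_mult[OF summable_norm_cancel])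
  qed
  finally have I: "(LINT t:{0<..<y}|lborel. frac_integrand \<eta> \<sigma> f y t) = \<dots>"
    unfolding F_sum set_lebesgue_integral_def .
  have "frac_integral \<eta> \<sigma> f y = - (LINT t:{0<..<y}|lborel. frac_integrand \<eta> \<sigma> f y t)"
    unfolding frac_integral_def interval_lebesgue_integral_def using y
    by (simp add: zero_ereal_def)
  then show ?thesis unfolding I by (simp add: c_def)
qed

lemma summable_affine_coeff:
  fixes e :: "nat \<Rightarrow> complex"
  assumes e: "\<And>s. norm s < R \<Longrightarrow> summable (\<lambda>n. e n * s ^ n)" and s: "norm s < R"
  shows "summable (\<lambda>n. (a + b * of_nat n) * e n * s ^ n)"
    and "(\<lambda>n. of_nat n * e n * s ^ n) sums (s * (\<Sum>n. diffs e n * s ^ n))"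
proof -
  have "summable (\<lambda>n. diffs e n * s ^ n)" by (rule termdiff_converges[OF s]) (rule e)
  from sums_mult[OF diffs_equiv[OF this], of s]
  have "(\<lambda>n. s * (of_nat n * e n * s ^ (n - Suc 0))) sums (s * (\<Sum>n. diffs e n * s ^ n))" .
  also have "(\<lambda>n. s * (of_nat n * e n * s ^ (n - Suc 0))) = (\<lambda>n. of_nat n * e n * s ^ n)"
  proof
    show "s * (of_nat n * e n * s ^ (n - Suc 0)) = of_nat n * e n * s ^ n" for n by (cases n) auto
  qed
  finally show 1: "(\<lambda>n. of_nat n * e n * s ^ n) sums (s * (\<Sum>n. diffs e n * s ^ n))" .
  have "summable (\<lambda>n. a * (e n * s ^ n) + b * (of_nat n * e n * s ^ n))"
    using 1 by (intro summable_add summable_mult e[OF s]) (rule sums_summable)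
  then show "summable (\<lambda>n. (a + b * of_nat n) * e n * s ^ n)" by (simp add: algebra_simps)
qed

text \<open>
  Functions of the form \<open>y\<^sup>\<gamma>\<close> times a power series in \<open>y\<^sup>\<nu>\<close> are mapped to functions of the same form,
  with \<open>\<gamma>\<close> lowered by \<open>\<eta>\<close>; the \<open>n\<close>-th term is just differentiated as a single power.
\<close>

lemma weighted_deriv_power_series:
  fixes e :: "nat \<Rightarrow> complex" and \<gamma> :: complex
  assumes e: "\<And>s. norm s < R \<Longrightarrow> summable (\<lambda>n. e n * s ^ n)"
    and y: "y > 0" "y powr \<nu> < R"
    and h: "\<forall>\<^sub>F u in nhds y. h u = of_real u powr \<gamma> * (\<Sum>n. e n * of_real (u powr \<nu>) ^ n)"
  shows "weighted_deriv \<eta> h y = of_real y powr (\<gamma> - of_real \<eta>) *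
    (\<Sum>n. - (\<gamma> + of_real (\<nu> * real n)) * e n * of_real (y powr \<nu>) ^ n)"
proof -
  define S where "S = (\<lambda>s. \<Sum>n. e n * s ^ n)"
  define S' where "S' = (\<lambda>s. \<Sum>n. diffs e n * s ^ n)"
  define s where "s = complex_of_real (y powr \<nu>)"
  have s: "norm s < R" using y by (simp add: s_def)
  obtain r where r: "y powr \<nu> < r" "r < R" using dense[OF y(2)] by blast
  have r0: "r > 0" using r(1) powr_ge_zero[of y \<nu>] by linarith
  have dS: "(S has_field_derivative S' s) (at s)"
    unfolding S_def S'_def
    by (rule termdiffs_strong[where K = "of_real r"]) (use r r0 e[of "of_real r"] in \<open>auto simp: s_def\<close>)
  have d1: "((\<lambda>u. complex_of_real (u powr \<nu>)) has_vector_derivative of_real (\<nu> * y powr (\<nu> - 1))) (at y)"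
    using y by (intro has_vector_derivative_of_real)
      (auto intro!: derivative_eq_intros)
  have d2: "((\<lambda>u. S (of_real (u powr \<nu>))) has_vector_derivative of_real (\<nu> * y powr (\<nu> - 1)) * S' s) (at y)"
    using field_vector_diff_chain_at[OF d1, of S "S' s"] dS by (simp add: o_def s_def)
  have d3: "((\<lambda>z. z powr \<gamma>) has_field_derivative \<gamma> * of_real y powr (\<gamma> - 1)) (at (complex_of_real y))"
    using y by (auto intro!: derivative_eq_intros)
  have d4: "((\<lambda>u. complex_of_real u powr \<gamma>) has_vector_derivative \<gamma> * of_real y powr (\<gamma> - 1)) (at y)"
    using field_vector_diff_chain_at[OF has_vector_derivative_of_real[OF DERIV_ident], of "\<lambda>z. z powr \<gamma>"] d3
    by (simp add: o_def)
  have "((\<lambda>u. of_real u powr \<gamma> * S (of_real (u powr \<nu>))) has_vector_derivative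
     of_real y powr \<gamma> * (of_real (\<nu> * y powr (\<nu> - 1)) * S' s) + \<gamma> * of_real y powr (\<gamma> - 1) * S s) (at y)"
    using has_vector_derivative_mult[OF d4 d2] by (simp add: s_def)
  then have "(h has_vector_derivative
     of_real y powr \<gamma> * (of_real (\<nu> * y powr (\<nu> - 1)) * S' s) + \<gamma> * of_real y powr (\<gamma> - 1) * S s) (at y)"
    using h by (subst has_vector_derivative_cong_ev[where g = "\<lambda>u. of_real u powr \<gamma> * S (of_real (u powr \<nu>))"])
      (auto simp: S_def elim!: eventually_mono dest: eventually_nhds_x_imp_x)
  then have "vector_derivative h (at y) =
     of_real y powr \<gamma> * (of_real (\<nu> * y powr (\<nu> - 1)) * S' s) + \<gamma> * of_real y powr (\<gamma> - 1) * S s"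
    by (rule vector_derivative_at)
  also have "complex_of_real (\<nu> * y powr (\<nu> - 1)) = of_real \<nu> * s * of_real y powr (-1)"
  proof -
    have "complex_of_real y powr (-1) = of_real (y powr (-1))" using y powr_minus[of "complex_of_real y" 1] by (simp add: powr_minus)
    then show ?thesis using y by (simp add: s_def powr_diff powr_minus divide_inverse)
  qed
  also have "of_real y powr \<gamma> * (of_real \<nu> * s * of_real y powr (-1) * S' s) =
      of_real y powr (\<gamma> - 1) * (of_real \<nu> * (s * S' s))"
    by (simp add: powr_diff powr_minus divide_inverse)
  finally have "vector_derivative h (at y) = of_real y powr (\<gamma> - 1) * (of_real \<nu> * (s * S' s) + \<gamma> * S s)"
    by (simp add: algebra_simps)
  moreover have "complex_of_real (y powr (1 - \<eta>)) * of_real y powr (\<gamma> - 1) = of_real y powr (\<gamma> - of_real \<eta>)"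
  proof -
    have "complex_of_real (y powr (1 - \<eta>)) = of_real y powr of_real (1 - \<eta>)" using y by (simp only: powr_of_real)
    moreover have "complex_of_real (1 - \<eta>) + (\<gamma> - 1) = \<gamma> - of_real \<eta>" by simp
    ultimately show ?thesis by (simp only: powr_add[symmetric])
  qed
  ultimately have W: "weighted_deriv \<eta> h y = of_real y powr (\<gamma> - of_real \<eta>) * (- (of_real \<nu> * (s * S' s) + \<gamma> * S s))"
    unfolding weighted_deriv_def by (simp only: mult_minus_left mult_minus_right mult.assoc[symmetric])
  have "(\<lambda>n. - (of_real \<nu> * (of_nat n * e n * s ^ n) + \<gamma> * (e n * s ^ n))) sums (- (of_real \<nu> * (s * S' s) + \<gamma> * S s))"
    unfolding S'_def S_def
    by (intro sums_minus sums_add sums_mult summable_affine_coeff(2)[OF e s] summable_sums e s)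
  then have "(\<lambda>n. - (\<gamma> + of_real (\<nu> * real n)) * e n * s ^ n) sums (- (of_real \<nu> * (s * S' s) + \<gamma> * S s))"
    by (simp add: algebra_simps)
  from sums_unique[OF this] show ?thesis unfolding W s_def by simp
qed

lemma iterated_weighted_deriv_power_series:
  fixes e :: "nat \<Rightarrow> complex" and \<gamma> :: complex
  assumes \<nu>: "\<nu> > 0" and e: "\<And>s. norm s < R \<Longrightarrow> summable (\<lambda>n. e n * s ^ n)"
    and h: "\<And>y. y > 0 \<Longrightarrow> y powr \<nu> < R \<Longrightarrow> h y = of_real y powr \<gamma> * (\<Sum>n. e n * of_real (y powr \<nu>) ^ n)"
    and y: "y > 0" "y powr \<nu> < R"
  shows "summable (\<lambda>n. (\<Prod>i<j. - (\<gamma> - of_real (real i * \<eta>) + of_real (\<nu> * real n))) * e n * of_real (y powr \<nu>) ^ n)"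
    and "(weighted_deriv \<eta> ^^ j) h y = of_real y powr (\<gamma> - of_real (real j * \<eta>)) *
    (\<Sum>n. (\<Prod>i<j. - (\<gamma> - of_real (real i * \<eta>) + of_real (\<nu> * real n))) * e n * of_real (y powr \<nu>) ^ n)"
proof -
  define c where "c j n = (\<Prod>i<j. - (\<gamma> - of_real (real i * \<eta>) + of_real (\<nu> * real n))) * e n" for j n
  have c_Suc: "c (Suc j) n = - ((\<gamma> - of_real (real j * \<eta>)) + of_real (\<nu> * real n)) * c j n" for j n
    by (simp add: c_def)
  have summ: "summable (\<lambda>n. c j n * s ^ n)" if "norm s < R" for j s
    using that
  proof (induction j arbitrary: s)
    case 0
    then show ?case using e by (simp add: c_def)
  next
    case (Suc j)
    have "c (Suc j) n = (- (\<gamma> - of_real (real j * \<eta>)) + (- of_real \<nu>) * of_nat n) * c j n" for n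
      unfolding c_Suc by simp
    then show ?case
      using summable_affine_coeff(1)[of R "c j" s, OF Suc.IH Suc.prems] by presburger
  qed
  have "(weighted_deriv \<eta> ^^ j) h y = of_real y powr (\<gamma> - of_real (real j * \<eta>)) *
    (\<Sum>n. c j n * of_real (y powr \<nu>) ^ n)"
    using y
  proof (induction j arbitrary: y)
    case 0
    then show ?case using h by (simp add: c_def)
  next
    case (Suc j)
    have "\<forall>\<^sub>F u in nhds y. 0 < u \<and> u powr \<nu> < R"
    proof (intro eventually_conj)
      show "\<forall>\<^sub>F u in nhds y. 0 < u" using Suc.prems by (intro order_tendstoD(1)[OF filterlim_ident]) auto
      have "((\<lambda>u. u powr \<nu>) \<longlongrightarrow> y powr \<nu>) (nhds y)"
        using Suc.prems by (intro tendsto_powr filterlim_ident tendsto_const) auto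
      then show "\<forall>\<^sub>F u in nhds y. u powr \<nu> < R" using Suc.prems by (intro order_tendstoD(2)) auto
    qed
    then have "\<forall>\<^sub>F u in nhds y. (weighted_deriv \<eta> ^^ j) h u = of_real u powr (\<gamma> - of_real (real j * \<eta>)) *
      (\<Sum>n. c j n * of_real (u powr \<nu>) ^ n)"
      by eventually_elim (rule Suc.IH, auto)
    from weighted_deriv_power_series[OF summ Suc.prems this, of \<eta>]
    have "(weighted_deriv \<eta> ^^ Suc j) h y = of_real y powr (\<gamma> - of_real (real j * \<eta>) - of_real \<eta>) *
       (\<Sum>n. c (Suc j) n * of_real (y powr \<nu>) ^ n)"
      unfolding c_Suc by simp
    moreover have "\<gamma> - of_real (real j * \<eta>) - of_real \<eta> = \<gamma> - of_real (real (Suc j) * \<eta>)"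
      by (simp add: algebra_simps)
    ultimately show ?case by (simp only:)
  qed
  then show "(weighted_deriv \<eta> ^^ j) h y = of_real y powr (\<gamma> - of_real (real j * \<eta>)) *
    (\<Sum>n. (\<Prod>i<j. - (\<gamma> - of_real (real i * \<eta>) + of_real (\<nu> * real n))) * e n * of_real (y powr \<nu>) ^ n)"
    by (simp add: c_def)
  show "summable (\<lambda>n. (\<Prod>i<j. - (\<gamma> - of_real (real i * \<eta>) + of_real (\<nu> * real n))) * e n * of_real (y powr \<nu>) ^ n)"
    using summ[of "of_real (y powr \<nu>)" j] y by (simp add: c_def)
qed

text \<open>
  Each factor lowers the argument of the reciprocal Gamma function by one. Working with \<open>rGamma\<close>
  makes this hold at the poles of Gamma as well, where the product has a vanishing factor.
\<close>

lemma Beta_times_falling_product: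
  fixes p \<alpha> :: complex
  shows "Beta p \<alpha> * (\<Prod>i<j. - (of_real \<eta> * (p + \<alpha> - 1) - of_real (real i * \<eta>))) =
    Gamma p * Gamma \<alpha> * (- of_real \<eta>) ^ j * rGamma (p + \<alpha> - of_nat j)"
proof (induction j)
  case 0
  then show ?case by (simp add: Beta_altdef)
next
  case (Suc j)
  define z where "z = p + \<alpha> - of_nat (Suc j)"
  have z: "z * rGamma (p + \<alpha> - of_nat j) = rGamma z"
    using rGamma_plus1[of z] by (simp add: z_def algebra_simps)
  have "Beta p \<alpha> * (\<Prod>i<Suc j. - (of_real \<eta> * (p + \<alpha> - 1) - of_real (real i * \<eta>))) =
     (Beta p \<alpha> * (\<Prod>i<j. - (of_real \<eta> * (p + \<alpha> - 1) - of_real (real i * \<eta>)))) * (- of_real \<eta> * z)"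
    by (simp add: z_def algebra_simps)
  also have "\<dots> = Gamma p * Gamma \<alpha> * (- of_real \<eta>) ^ Suc j * (z * rGamma (p + \<alpha> - of_nat j))"
    unfolding Suc by (simp add: mult_ac)
  finally show ?case unfolding z unfolding z_def .
qed

text \<open>
  The factor \<open>Gamma (N - \<sigma>)\<close> produced by the Beta functions cancels against the normalisation of the
  fractional derivative. The summability statement is needed to see that the resulting power series
  in \<open>z\<close> converges on the whole unit disc.
\<close>

lemma frac_deriv_power_series:
  fixes e :: "nat \<Rightarrow> complex" and \<sigma> \<mu> :: complex
  assumes \<eta>: "\<eta> > 0" and \<nu>: "\<nu> > 0" and \<mu>: "Re \<mu> > 0" and x: "x > 0" "x powr \<nu> < R"
    and e: "\<And>s. norm s < R \<Longrightarrow> summable (\<lambda>n. e n * s ^ n)"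
    and f: "\<And>t. t > 0 \<Longrightarrow> t powr \<nu> < R \<Longrightarrow>
      f t = of_real t powr \<mu> * (\<Sum>n. e n * of_real (t powr \<nu>) ^ n)"
  defines "p \<equiv> \<lambda>n. (\<mu> + of_real (\<nu> * real n)) / of_real \<eta> + 1"
  shows "summable (\<lambda>n. e n * Gamma (p n) * rGamma (p n - \<sigma>) * of_real (x powr \<nu>) ^ n)"
    and "frac_deriv \<eta> \<sigma> f x = (-1) powr (- \<sigma>) * of_real \<eta> powr \<sigma> * of_real x powr (\<mu> - \<sigma> * of_real \<eta>) *
    (\<Sum>n. e n * Gamma (p n) * rGamma (p n - \<sigma>) * of_real (x powr \<nu>) ^ n)"
proof -
  define N where "N = frac_order \<sigma>"
  define \<alpha> where "\<alpha> = of_nat N - \<sigma>"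
  define \<gamma> where "\<gamma> = \<mu> + of_real \<eta> * \<alpha>"
  define K where "K = - (exp (\<i> * of_real pi * (\<alpha> - 1)) / of_real \<eta>)"
  define E where "E n = K * (e n * Beta (p n) \<alpha>)" for n
  have \<alpha>: "Re \<alpha> > 0" unfolding \<alpha>_def N_def by (rule Re_frac_order_minus)
  have summ: "summable (\<lambda>n. e n * Beta (p n) \<alpha> * s ^ n)" if "norm s < R" for s
  proof -
    have "summable (\<lambda>n. norm (e n * Beta (p n) \<alpha> * of_real (norm s) ^ n))"
      using summable_times_Beta(2)[OF \<eta> \<nu> \<mu> \<alpha> e _ that] by (simp add: p_def)
    then have "summable (\<lambda>n. norm (e n * Beta (p n) \<alpha> * s ^ n))" by (simp add: norm_mult norm_power)
    then show ?thesis by (rule summable_norm_cancel)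
  qed
  have E: "summable (\<lambda>n. E n * s ^ n)" if "norm s < R" for s
    using summable_mult[OF summ[OF that], of K] by (simp add: E_def mult.assoc)
  have int: "frac_integral \<eta> \<sigma> f y = of_real y powr \<gamma> * (\<Sum>n. E n * of_real (y powr \<nu>) ^ n)"
    if y: "y > 0" "y powr \<nu> < R" for y
  proof -
    have "f t = of_real t powr \<mu> * (\<Sum>n. e n * of_real (t powr \<nu>) ^ n)" if "0 < t" "t < y" for t
      using powr_less_mono2[of \<nu> t y] that \<nu> y by (intro f) auto
    from frac_integral_power_series[OF \<eta> \<nu> \<mu> y e this, of \<sigma>]
    have "frac_integral \<eta> \<sigma> f y = K * (of_real y powr \<gamma> * (\<Sum>n. e n * Beta (p n) \<alpha> * of_real (y powr \<nu>) ^ n))"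
      by (simp add: K_def \<gamma>_def \<alpha>_def N_def p_def)
    also have "\<dots> = of_real y powr \<gamma> * (\<Sum>n. K * (e n * Beta (p n) \<alpha> * of_real (y powr \<nu>) ^ n))"
      using y by (subst suminf_mult) (auto intro!: summ)
    finally show ?thesis by (simp add: E_def mult.assoc)
  qed
  have coeff: "(\<Prod>i<N. - (\<gamma> - of_real (real i * \<eta>) + of_real (\<nu> * real n))) * E n * of_real (x powr \<nu>) ^ n =
     K * Gamma \<alpha> * (- of_real \<eta>) ^ N * (e n * Gamma (p n) * rGamma (p n - \<sigma>) * of_real (x powr \<nu>) ^ n)" for n
  proof -
    have "\<gamma> - of_real (real i * \<eta>) + of_real (\<nu> * real n) = of_real \<eta> * (p n + \<alpha> - 1) - of_real (real i * \<eta>)" for i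
      using \<eta> by (simp add: \<gamma>_def p_def field_simps)
    then have P: "(\<Prod>i<N. - (\<gamma> - of_real (real i * \<eta>) + of_real (\<nu> * real n))) =
       (\<Prod>i<N. - (of_real \<eta> * (p n + \<alpha> - 1) - of_real (real i * \<eta>)))"
      by (simp only:)
    have "(\<Prod>i<N. - (\<gamma> - of_real (real i * \<eta>) + of_real (\<nu> * real n))) * E n =
       K * e n * (Beta (p n) \<alpha> * (\<Prod>i<N. - (of_real \<eta> * (p n + \<alpha> - 1) - of_real (real i * \<eta>))))"
      unfolding P E_def by (simp only: mult_ac)
    also have "\<dots> = K * e n * (Gamma (p n) * Gamma \<alpha> * (- of_real \<eta>) ^ N * rGamma (p n + \<alpha> - of_nat N))"
      unfolding Beta_times_falling_product ..
    also have "p n + \<alpha> - of_nat N = p n - \<sigma>" by (simp add: \<alpha>_def)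
    finally show ?thesis by (simp add: mult_ac)
  qed
  define Q where "Q = (\<lambda>n. e n * Gamma (p n) * rGamma (p n - \<sigma>) * of_real (x powr \<nu>) ^ n)"
  have nz: "K * Gamma \<alpha> * (- of_real \<eta>) ^ N \<noteq> 0"
    using \<eta> not_nonpos_Int_of_Re_pos[OF \<alpha>] by (simp add: K_def Gamma_eq_zero_iff)
  have Gx: "Gamma \<alpha> \<noteq> 0" using not_nonpos_Int_of_Re_pos[OF \<alpha>] by (simp add: Gamma_eq_zero_iff)
  have "summable (\<lambda>n. K * Gamma \<alpha> * (- of_real \<eta>) ^ N * Q n)"
    using iterated_weighted_deriv_power_series(1)[OF \<nu> E int x, where j = N and \<eta> = \<eta>]
    unfolding coeff Q_def .
  then have Q: "summable Q" using nz by (rule summable_mult_D)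
  then show "summable (\<lambda>n. e n * Gamma (p n) * rGamma (p n - \<sigma>) * of_real (x powr \<nu>) ^ n)"
    unfolding Q_def .
  have "(weighted_deriv \<eta> ^^ N) (frac_integral \<eta> \<sigma> f) x = of_real x powr (\<gamma> - of_real (real N * \<eta>)) *
      (\<Sum>n. K * Gamma \<alpha> * (- of_real \<eta>) ^ N * Q n)"
    using iterated_weighted_deriv_power_series(2)[OF \<nu> E int x, where j = N and \<eta> = \<eta>] unfolding coeff Q_def .
  also have "(\<Sum>n. K * Gamma \<alpha> * (- of_real \<eta>) ^ N * Q n) = K * Gamma \<alpha> * (- of_real \<eta>) ^ N * suminf Q"
    by (rule suminf_mult[OF Q])
  also have "\<gamma> - of_real (real N * \<eta>) = \<mu> - \<sigma> * of_real \<eta>" by (simp add: \<gamma>_def \<alpha>_def algebra_simps)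
  finally have D: "frac_deriv \<eta> \<sigma> f x = of_real \<eta> powr (\<sigma> - of_nat N + 1) * K * (- of_real \<eta>) ^ N *
     (of_real x powr (\<mu> - \<sigma> * of_real \<eta>) * suminf Q)"
    unfolding frac_deriv_def N_def[symmetric] \<alpha>_def[symmetric] using Gx by simp
  have "of_real \<eta> powr (\<sigma> - of_nat N + 1) * K * (- of_real \<eta>) ^ N = (-1) powr (- \<sigma>) * of_real \<eta> powr \<sigma>"
  proof -
    have 1: "of_real \<eta> powr (\<sigma> - of_nat N + 1) = of_real \<eta> powr \<sigma> * of_real \<eta> / of_real \<eta> ^ N"
      using \<eta> by (simp add: powr_add powr_diff powr_nat')
    have 2: "(-1) powr (- \<sigma>) = exp (- (\<i> * of_real pi * \<sigma>))"
      using of_real_minus_powr[of 1 "- \<sigma>"] by simp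
    have "\<i> * of_real pi * (\<alpha> - 1) = of_nat N * (\<i> * of_real pi) - \<i> * of_real pi - \<i> * of_real pi * \<sigma>"
      by (simp add: \<alpha>_def algebra_simps)
    then have 3: "exp (\<i> * of_real pi * (\<alpha> - 1)) = - ((-1) ^ N * exp (- (\<i> * of_real pi * \<sigma>)))"
      by (simp only: exp_diff exp_of_nat_mult exp_pi_i' exp_minus divide_inverse) simp
    have 4: "(- of_real \<eta>) ^ N = (-1) ^ N * complex_of_real \<eta> ^ N"
      by (metis mult_minus1 power_mult_distrib)
    have "Q * H / P * - (- (M * E) / H) * (M * P) = E * Q"
      if "H \<noteq> 0" "P \<noteq> 0" "M * M = 1" for Q H P M E :: complex
    proof -
      have "Q * H / P * - (- (M * E) / H) * (M * P) = (M * M) * (E * Q)"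
        using that(1,2) by simp
      then show ?thesis using that(3) by simp
    qed
    moreover have "(-1) ^ N * (-1) ^ N = (1 :: complex)" by (simp flip: power_mult_distrib)
    ultimately show ?thesis unfolding 1 2 K_def 3 4 using \<eta> by simp
  qed
  then show "frac_deriv \<eta> \<sigma> f x = (-1) powr (- \<sigma>) * of_real \<eta> powr \<sigma> * of_real x powr (\<mu> - \<sigma> * of_real \<eta>) *
    (\<Sum>n. e n * Gamma (p n) * rGamma (p n - \<sigma>) * of_real (x powr \<nu>) ^ n)"
    unfolding D Q_def by (simp add: mult.assoc)
qed

section \<open>The Beta transform of a power series\<close>

text \<open>
  The series in the assumption \<open>sum\<close> is the one of the integrals of the norms of the terms. It is needed
  because the power series may fail to converge absolutely at \<open>z = 1\<close>, the end point of the
  integration.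
\<close>

lemma Beta_transform_power_series:
  fixes D :: "nat \<Rightarrow> complex"
  assumes \<nu>: "\<nu> > 0" and l: "Re l > 0" and m: "Re m > 0"
    and D: "\<And>s. norm s < 1 \<Longrightarrow> summable (\<lambda>n. D n * s ^ n)"
    and sum: "summable (\<lambda>n. norm (D n) * Beta (Re l + \<nu> * real n) (Re m))"
    and g: "\<And>z. 0 < z \<Longrightarrow> z < 1 \<Longrightarrow> g z = C * (\<Sum>n. D n * of_real (z powr \<nu>) ^ n)"
  shows "Beta_transform g l m = (\<Sum>n. C * (D n * Beta (l + of_real (\<nu> * real n)) m))"
proof -
  let ?k = "\<lambda>n v. complex_of_real v powr ((l + of_real (\<nu> * real n)) - 1) * of_real (1 - v) powr (m - 1)"
  define F where "F n v = indicator {0<..<1} v *\<^sub>R (C * D n * ?k n v)" for n v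
  have l': "Re (l + of_real (\<nu> * real n)) > 0" for n using l \<nu> by (simp add: add_pos_nonneg)
  have k: "?k n v = of_real v powr (l - 1) * of_real (1 - v) powr (m - 1) * of_real (v powr \<nu>) ^ n" if "v > 0" for n v
  proof -
    have "l + of_real (\<nu> * real n) - 1 = (l - 1) + of_real (\<nu> * real n)" by simp
    then show ?thesis by (simp only: of_real_powr_progression[OF that] mult_ac)
  qed
  have small: "v powr \<nu> < 1" if "0 < v" "v < 1" for v
    using powr_less_mono2[of \<nu> v 1] that \<nu> by simp
  have F_eq: "F n v = C * of_real v powr (l - 1) * of_real (1 - v) powr (m - 1) * (D n * of_real (v powr \<nu>) ^ n)"
    if "v \<in> {0<..<1}" for n v
    using that k[of v n] by (simp add: F_def)
  have F_sum: "(\<Sum>n. F n v) = indicator {0<..<1} v *\<^sub>R Beta_integrand g l m v" for v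
  proof (cases "v \<in> {0<..<1}")
    case True
    then have v: "norm (complex_of_real (v powr \<nu>)) < 1" using small[of v] by simp
    show ?thesis unfolding F_eq[OF True] suminf_mult[OF D[OF v]]
      using True g[of v] by (simp add: Beta_integrand_def)
  qed (simp add: F_def)
  have int_F: "integrable lborel (F n)" for n
    using set_integrable_mult_right[OF set_integrable_Beta_complex[OF l' m], of "C * D n" n]
    unfolding set_integrable_def F_def .
  have F_int: "(\<integral>v. F n v \<partial>lborel) = C * (D n * Beta (l + of_real (\<nu> * real n)) m)" for n
  proof -
    have "(\<integral>v. F n v \<partial>lborel) = (LINT v:{0<..<1}|lborel. C * D n * ?k n v)"
      unfolding F_def set_lebesgue_integral_def ..
    also have "\<dots> = C * D n * (LINT v:{0<..<1}|lborel. ?k n v)" by (rule set_integral_mult_right)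
    finally show ?thesis unfolding integral_Beta_complex[OF l' m] by (simp add: mult_ac)
  qed
  have F_norm: "(\<integral>v. norm (F n v) \<partial>lborel) = norm C * (norm (D n) * Beta (Re l + \<nu> * real n) (Re m))" for n
  proof -
    have "(\<integral>v. norm (F n v) \<partial>lborel) = (LINT v:{0<..<1}|lborel. norm C * norm (D n) * norm (?k n v))"
      unfolding F_def set_lebesgue_integral_def norm_scaleR norm_mult by (simp add: abs_of_nonneg mult_ac)
    also have "\<dots> = norm C * norm (D n) * (LINT v:{0<..<1}|lborel. norm (?k n v))"
      by (rule set_integral_mult_right)
    finally show ?thesis unfolding integral_norm_Beta_complex[OF l' m] by (simp add: mult_ac)
  qed
  have "AE v in lborel. summable (\<lambda>n. norm (F n v))"
  proof (rule AE_I2)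
    fix v :: real
    show "summable (\<lambda>n. norm (F n v))"
    proof (cases "v \<in> {0<..<1}")
      case True
      then have "summable (\<lambda>n. norm (D n) * (v powr \<nu>) ^ n)"
        using small[of v] by (intro powser_summable_norm[OF D]) auto
      then show ?thesis unfolding F_eq[OF True] norm_mult[of _ "_ * _ ^ _"]
        by (intro summable_mult) (simp add: norm_mult norm_power)
    qed (simp add: F_def)
  qed
  moreover have "summable (\<lambda>n. \<integral>v. norm (F n v) \<partial>lborel)"
    unfolding F_norm by (rule summable_mult[OF sum])
  ultimately have "(\<integral>v. (\<Sum>n. F n v) \<partial>lborel) = (\<Sum>n. \<integral>v. F n v \<partial>lborel)"
    by (intro integral_suminf int_F)
  then have "(LINT v:{0<..<1}|lborel. Beta_integrand g l m v) = (\<Sum>n. C * (D n * Beta (l + of_real (\<nu> * real n)) m))"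
    unfolding F_int F_sum set_lebesgue_integral_def .
  then show ?thesis
    unfolding Beta_transform_def interval_lebesgue_integral_def
    by (simp add: zero_ereal_def one_ereal_def)
qed

section \<open>Fox-Wright and Mittag-Leffler terms\<close>

lemma Stirling_growth_Gamma_product:
  assumes "\<forall>(a, \<alpha>) \<in> set as. \<alpha> > 0"
  shows "\<exists>A \<kappa> B. Stirling_growth (\<lambda>n. \<Prod>(a, \<alpha>)\<leftarrow>as. Gamma (a + of_real \<alpha> * of_nat n)) A \<kappa> B"
  using assms
proof (induction as)
  case Nil
  then show ?case using Stirling_growth_const[of 1] by auto
next
  case (Cons u as)
  obtain a \<alpha> where u: "u = (a, \<alpha>)" by force
  then have "\<alpha> > 0" using Cons.prems by simp
  moreover obtain A \<kappa> B where "Stirling_growth (\<lambda>n. \<Prod>(a, \<alpha>)\<leftarrow>as. Gamma (a + of_real \<alpha> * of_nat n)) A \<kappa> B"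
    using Cons by auto
  ultimately show ?case using Stirling_growth_mult[OF Stirling_growth_Gamma] by (fastforce simp: u)
qed

text \<open>
  At a positive argument the power only enters the exponential rate \<open>B\<close>; powers of other complex
  numbers would rotate from term to term and leave the growth class.
\<close>

lemma Fox_Wright_term_growth:
  assumes "\<forall>(a, \<alpha>) \<in> set as. \<alpha> > 0" "\<forall>(b, \<beta>) \<in> set bs. \<beta> > 0" "z > 0"
  shows "\<exists>A \<kappa> B. Stirling_growth (Fox_Wright_term as bs (of_real z)) A \<kappa> B"
proof -
  obtain A \<kappa> B A' \<kappa>' B' where
    "Stirling_growth (\<lambda>n. \<Prod>(a, \<alpha>)\<leftarrow>as. Gamma (a + of_real \<alpha> * of_nat n)) A \<kappa> B"
    "Stirling_growth (\<lambda>n. \<Prod>(b, \<beta>)\<leftarrow>bs. Gamma (b + of_real \<beta> * of_nat n)) A' \<kappa>' B'"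
    using Stirling_growth_Gamma_product assms(1,2) by meson
  from Stirling_growth_mult[OF Stirling_growth_divide[OF this]
      Stirling_growth_divide[OF Stirling_growth_power[OF assms(3)] Stirling_growth_fact]]
  show ?thesis unfolding Fox_Wright_term_def[abs_def] by blast
qed

text \<open>The powers of \<open>k\<close> in the \<open>k\<close>-Pochhammer symbol and in the \<open>k\<close>-Gamma function combine.\<close>

lemma k_Mittag_Leffler_term_eq:
  assumes k: "k > 0" and \<xi>: "\<xi> / of_real k = of_real r"
  shows "k_Mittag_Leffler_term k \<xi> \<zeta> \<theta> q z n =
    of_real k powr (1 - \<zeta> / of_real k) / Gamma (\<theta> / of_real k) * of_real (k powr (q - r)) ^ n *
    (Gamma (\<theta> / of_real k + of_real q * of_nat n) /
     (Gamma (\<zeta> / of_real k + of_real r * of_nat n) * fact n)) * z ^ n"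
proof -
  have arg: "(of_nat n * \<xi> + \<zeta>) / of_real k = \<zeta> / of_real k + of_real r * of_nat n"
    using \<xi> k by (simp add: field_simps)
  have "complex_of_real k powr of_real (real n * q) =
      (of_real k powr (1 - \<zeta> / of_real k) * of_real (k powr (q - r)) ^ n) *
      of_real k powr (\<zeta> / of_real k + of_real r * of_nat n - 1)"
    unfolding of_real_powr_progression[OF k, symmetric] powr_add[symmetric]
    by (simp add: algebra_simps)
  moreover have "complex_of_real k powr (\<zeta> / of_real k + of_real r * of_nat n - 1) \<noteq> 0" using k by simp
  ultimately show ?thesis
    unfolding k_Mittag_Leffler_term_def k_pochhammer_def k_Gamma_def real_pochhammer_def arg
    by (simp add: mult.commute[of "of_nat n"])
qed

text \<open>
  Convergence at positive arguments arbitrarily close to \<open>x\<^sup>\<nu>\<close> gives a radius of convergence of at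
  least \<open>x\<^sup>\<nu>\<close>.
\<close>

lemma summable_powser_of_dense_radii:
  fixes c :: "nat \<Rightarrow> complex"
  assumes \<nu>: "\<nu> > 0" and x: "x > 0"
    and c: "\<And>z. 0 < z \<Longrightarrow> z < 1 \<Longrightarrow> summable (\<lambda>n. c n * of_real ((x * z) powr \<nu>) ^ n)"
    and s: "norm s < x powr \<nu>"
  shows "summable (\<lambda>n. c n * s ^ n)"
proof -
  obtain \<rho> where \<rho>: "norm s < \<rho>" "\<rho> < x powr \<nu>" using dense[OF s] by blast
  then have \<rho>0: "\<rho> > 0" using norm_ge_zero[of s] by linarith
  define z where "z = \<rho> powr (1 / \<nu>) / x"
  have "\<rho> powr (1 / \<nu>) < (x powr \<nu>) powr (1 / \<nu>)" using \<rho> \<rho>0 \<nu> by (intro powr_less_mono2) auto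
  then have z: "0 < z" "z < 1" using \<nu> x \<rho>0 by (simp_all add: z_def powr_powr)
  have "(x * z) powr \<nu> = \<rho>" using x \<nu> \<rho>0 by (simp add: z_def powr_powr)
  then have "summable (\<lambda>n. c n * of_real \<rho> ^ n)" using c[OF z] by simp
  then show ?thesis by (rule powser_inside) (use \<rho> \<rho>0 in simp)
qed

theorem theorem4:
  fixes x \<eta> \<nu> k q :: real and \<sigma> \<mu> \<xi> \<zeta> \<theta> l m :: complex
  defines "f \<equiv> \<lambda>z t. of_real t powr \<mu> * k_Mittag_Leffler k \<xi> \<zeta> \<theta> q (of_real ((t * z) powr \<nu>))"
    and "A \<equiv> \<lambda>z. {t. summable (k_Mittag_Leffler_term k \<xi> \<zeta> \<theta> q (of_real ((t * z) powr \<nu>)))}"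
    and "as \<equiv> [(\<theta> / of_real k, q), (\<mu> / of_real \<eta> + 1, \<nu> / \<eta>), (l, \<nu>)]"
    and "bs \<equiv> [(\<zeta> / of_real k, Re (\<xi> / of_real k)), (\<mu> / of_real \<eta> - \<sigma> + 1, \<nu> / \<eta>), (l + m, \<nu>)]"
    and "w \<equiv> of_real k powr (of_real q - \<xi> / of_real k) * of_real (x powr \<nu>)"
  assumes "x > 0" and "Re \<sigma> > 0" and "Re \<xi> > 0" and "Re \<zeta> > 0" and "Re \<theta> > 0"
    and "Re \<mu> > 0" and "Re l > 0" and "Re m > 0" and "\<eta> > 0" and "q > 0"
    and "\<xi> / of_real k \<in> \<real>" and "Re (\<xi> / of_real k) > 0"
    and "\<nu> / \<eta> > 0" and "\<nu> > 0"
    and "1 + Re (\<xi> / of_real k) - q \<ge> 0"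
    and "\<And>z. z \<in> {0<..<1} \<Longrightarrow> frac_deriv_defined \<eta> \<sigma> (A z) (f z) x"
    and "Beta_transform_defined (\<lambda>z. frac_deriv \<eta> \<sigma> (f z) x) l m"
    and "summable (Fox_Wright_term as bs w)"
  shows "Beta_transform (\<lambda>z. frac_deriv \<eta> \<sigma> (f z) x) l m =
    (-1) powr (- \<sigma>) * Gamma m * of_real x powr (\<mu> - \<sigma> * of_real \<eta>) *
    (of_real \<eta> powr \<sigma> / Gamma (\<theta> / of_real k)) * of_real k powr (1 - \<zeta> / of_real k) *
    Fox_Wright as bs w"
proof -
  note x = \<open>x > 0\<close> and \<eta> = \<open>\<eta> > 0\<close> and \<nu> = \<open>\<nu> > 0\<close> and \<mu> = \<open>Re \<mu> > 0\<close> and l = \<open>Re l > 0\<close> and m = \<open>Re m > 0\<close>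
  define r where "r = Re (\<xi> / of_real k)"
  have \<xi>: "\<xi> / of_real k = of_real r"
    using \<open>\<xi> / of_real k \<in> \<real>\<close> by (simp add: r_def complex_is_Real_iff complex_eq_iff)
  have r: "r > 0" using \<open>Re (\<xi> / of_real k) > 0\<close> by (simp add: r_def)
  \<comment> \<open>Both \<open>\<xi>/k\<close> and \<open>Re \<xi>\<close> are positive, so \<open>\<xi>\<close> is real and has the sign of \<open>k\<close>.\<close>
  have k: "k > 0"
  proof -
    have "k \<noteq> 0" using r \<xi> by auto
    then have "\<xi> = of_real (r * k)" using \<xi> by (simp add: field_simps)
    then have "r * k > 0" using \<open>Re \<xi> > 0\<close> by simp
    then show ?thesis using r by (simp add: zero_less_mult_iff)
  qed
  define c0 where "c0 = of_real k powr (1 - \<zeta> / of_real k) / Gamma (\<theta> / of_real k)"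
  define c where "c n = c0 * of_real (k powr (q - r)) ^ n *
     (Gamma (\<theta> / of_real k + of_real q * of_nat n) / (Gamma (\<zeta> / of_real k + of_real r * of_nat n) * fact n))" for n
  have ml_eq: "k_Mittag_Leffler_term k \<xi> \<zeta> \<theta> q z = (\<lambda>n. c n * z ^ n)" for z
    by (rule ext) (simp only: k_Mittag_Leffler_term_eq[OF k \<xi>] c_def c0_def)
  have c_summable: "summable (\<lambda>n. c n * s ^ n)" if "norm s < x powr \<nu>" for s
  proof (rule summable_powser_of_dense_radii[OF \<nu> x _ that])
    fix z :: real assume z: "0 < z" "z < 1"
    then obtain b where "b > x" "{0<..<b} \<subseteq> A z"
      using assms(21)[of z] unfolding frac_deriv_defined_def by auto
    then have "x \<in> A z" using x by auto
    then show "summable (\<lambda>n. c n * of_real ((x * z) powr \<nu>) ^ n)" by (simp add: A_def ml_eq)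
  qed
  define p where "p n = (\<mu> + of_real (\<nu> * real n)) / of_real \<eta> + 1" for n
  define D where "D n = c n * Gamma (p n) * rGamma (p n - \<sigma>) * of_real (x powr \<nu>) ^ n" for n
  define C where "C = (-1) powr (- \<sigma>) * of_real \<eta> powr \<sigma> * of_real x powr (\<mu> - \<sigma> * of_real \<eta>)"
  \<comment> \<open>As a power series in \<open>t\<^sup>\<nu>\<close> the function \<open>f z\<close> converges below \<open>(x/z)\<^sup>\<nu>\<close>, which exceeds \<open>x\<^sup>\<nu>\<close>.\<close>
  have deriv: "summable (\<lambda>n. D n * of_real (z powr \<nu>) ^ n)"
    "frac_deriv \<eta> \<sigma> (f z) x = C * (\<Sum>n. D n * of_real (z powr \<nu>) ^ n)" if z: "0 < z" "z < 1" for z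
  proof -
    define e where "e n = c n * of_real (z powr \<nu>) ^ n" for n
    have R: "(x / z) powr \<nu> * z powr \<nu> = x powr \<nu>" using x z by (simp add: powr_divide)
    have e: "summable (\<lambda>n. e n * s ^ n)" if s: "norm s < (x / z) powr \<nu>" for s
    proof -
      have "norm s * z powr \<nu> < x powr \<nu>" unfolding R[symmetric] using s z by (intro mult_strict_right_mono) auto
      then have "summable (\<lambda>n. c n * (s * of_real (z powr \<nu>)) ^ n)" by (intro c_summable) (simp add: norm_mult)
      then show ?thesis by (simp add: e_def power_mult_distrib mult_ac)
    qed
    have f: "f z t = of_real t powr \<mu> * (\<Sum>n. e n * of_real (t powr \<nu>) ^ n)" if "t > 0" for t
      using that z by (simp add: f_def k_Mittag_Leffler_def ml_eq e_def powr_mult power_mult_distrib mult_ac)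
    have xz: "x powr \<nu> < (x / z) powr \<nu>" using x z \<nu> by (intro powr_less_mono2) (auto simp: field_simps)
    have eq: "e n * Gamma (p n) * rGamma (p n - \<sigma>) * of_real (x powr \<nu>) ^ n = D n * of_real (z powr \<nu>) ^ n" for n
      by (simp add: e_def D_def mult_ac)
    note series = frac_deriv_power_series[OF \<eta> \<nu> \<mu> x xz e f, of \<sigma>, folded p_def, unfolded eq, folded C_def]
    show "summable (\<lambda>n. D n * of_real (z powr \<nu>) ^ n)"
      "frac_deriv \<eta> \<sigma> (f z) x = C * (\<Sum>n. D n * of_real (z powr \<nu>) ^ n)"
      using series by auto
  qed
  have D_summable: "summable (\<lambda>n. D n * s ^ n)" if "norm s < 1" for s
    using summable_powser_of_dense_radii[OF \<nu>, of 1 D s] deriv(1) that by simp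
  define T where "T = Fox_Wright_term as bs w"
  have w: "w = of_real (k powr (q - r) * x powr \<nu>)"
  proof -
    have "of_real k powr (of_real q - \<xi> / of_real k) = complex_of_real k powr of_real (q - r)" by (simp add: \<xi>)
    also have "\<dots> = of_real (k powr (q - r))" using k by (intro powr_of_real) auto
    finally show ?thesis by (simp add: w_def)
  qed
  have T_Beta: "D n * Beta (l + of_real (\<nu> * real n)) m = c0 * Gamma m * T n" for n
  proof -
    have "p n = \<mu> / of_real \<eta> + 1 + of_real (\<nu> / \<eta>) * of_nat n"
      "p n - \<sigma> = \<mu> / of_real \<eta> - \<sigma> + 1 + of_real (\<nu> / \<eta>) * of_nat n"
      by (simp_all add: p_def add_divide_distrib)
    moreover have "l + of_real (\<nu> * real n) = l + of_real \<nu> * of_nat n"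
      "l + of_real (\<nu> * real n) + m = l + m + of_real \<nu> * of_nat n" by simp_all
    ultimately show ?thesis
      unfolding D_def c_def T_def Fox_Wright_term_def as_def bs_def r_def[symmetric] w Beta_def rGamma_inverse_Gamma
      by (simp only: list.map prod_list.Cons prod_list.Nil case_prod_conv of_real_mult power_mult_distrib divide_inverse inverse_mult_distrib inverse_1 mult_1_left mult_1_right mult_ac)
  qed
  have "summable (\<lambda>n. norm (D n) * Beta (Re l + \<nu> * real n) (Re m))"
  proof -
    obtain P \<kappa> B where T: "Stirling_growth T P \<kappa> B"
      using Fox_Wright_term_growth[of as bs "k powr (q - r) * x powr \<nu>"] \<open>q > 0\<close> \<nu> \<eta> r k x
      unfolding T_def w by (auto simp: as_def bs_def r_def)
    \<comment> \<open>Up to Gamma factors in \<open>m\<close>, \<open>B1\<close> and \<open>B2\<close> are the Beta functions for \<open>l\<close>, \<open>m\<close> and for their real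
       parts. Multiplying by \<open>B2 n / B1 n\<close> shifts \<open>\<kappa>\<close> by the imaginary number \<open>m - Re m\<close>.\<close>
    define B1 where "B1 n = Gamma (l + of_real \<nu> * of_nat n) / Gamma (l + m + of_real \<nu> * of_nat n)" for n
    define B2 where "B2 n = Gamma (complex_of_real (Re l) + of_real \<nu> * of_nat n) / Gamma (of_real (Re l + Re m) + of_real \<nu> * of_nat n)" for n
    have "Stirling_growth (\<lambda>n. T n * (B2 n / B1 n)) P (\<kappa> + (- of_real (Re m) + m)) B"
      using Stirling_growth_mult[OF T Stirling_growth_divide[OF
          Stirling_growth_divide[OF Stirling_growth_Gamma[OF \<nu>] Stirling_growth_Gamma[OF \<nu>]]
          Stirling_growth_divide[OF Stirling_growth_Gamma[OF \<nu>] Stirling_growth_Gamma[OF \<nu>]]],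
          of "of_real (Re l)" "of_real (Re l + Re m)" l "l + m"]
      by (simp add: B1_def B2_def)
    then have "summable (\<lambda>n. norm (T n * (B2 n / B1 n)))"
      using assms(23) T unfolding T_def[symmetric] by (elim Stirling_growth_summable_transfer[rotated]) simp_all
    then have "summable (\<lambda>n. norm (c0 * Gamma (of_real (Re m))) * norm (T n * (B2 n / B1 n)))"
      by (rule summable_mult)
    also have "(\<lambda>n. norm (c0 * Gamma (of_real (Re m))) * norm (T n * (B2 n / B1 n))) =
        (\<lambda>n. norm (D n) * Beta (Re l + \<nu> * real n) (Re m))"
    proof
      fix n
      have l': "Re (l + of_real \<nu> * of_nat n) > 0" using l \<nu> by (simp add: add_pos_nonneg)
      have nz: "B1 n \<noteq> 0" "Gamma m \<noteq> 0"
        using not_nonpos_Int_of_Re_pos[OF l'] not_nonpos_Int_of_Re_pos[OF m]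
          not_nonpos_Int_of_Re_pos[of "l + m + of_real \<nu> * of_nat n"] l' m
        by (simp_all add: B1_def Gamma_eq_zero_iff)
      have "Beta (l + of_real (\<nu> * real n)) m = B1 n * Gamma m" by (simp add: Beta_def B1_def add_ac)
      then have "D n * B1 n * Gamma m = c0 * Gamma m * T n" using T_Beta[of n] by (simp add: mult_ac)
      then have D: "D n = c0 * T n / B1 n" using nz by (simp add: field_simps)
      have "complex_of_real (Beta (Re l + \<nu> * real n) (Re m)) = B2 n * Gamma (of_real (Re m))"
        unfolding Beta_complex_of_real[symmetric] unfolding Beta_def B2_def by (simp add: add_ac)
      moreover have "Beta (Re l + \<nu> * real n) (Re m) \<ge> 0"
        using order_trans[OF norm_ge_zero norm_Beta_le[OF l' m]] by simp
      ultimately have "Beta (Re l + \<nu> * real n) (Re m) = norm (B2 n * Gamma (of_real (Re m)))"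
        by (metis norm_of_real abs_of_nonneg)
      then show "norm (c0 * Gamma (of_real (Re m))) * norm (T n * (B2 n / B1 n)) = norm (D n) * Beta (Re l + \<nu> * real n) (Re m)"
        unfolding D by (simp add: norm_mult norm_divide)
    qed
    finally show ?thesis .
  qed
  from Beta_transform_power_series[OF \<nu> l m D_summable this deriv(2)]
  have "Beta_transform (\<lambda>z. frac_deriv \<eta> \<sigma> (f z) x) l m = (\<Sum>n. C * (c0 * Gamma m * T n))"
    unfolding T_Beta .
  also have "\<dots> = (\<Sum>n. C * c0 * Gamma m * T n)" by (simp only: mult.assoc)
  also have "\<dots> = C * c0 * Gamma m * Fox_Wright as bs w"
    unfolding Fox_Wright_def T_def using assms(23) by (rule suminf_mult)
  finally show ?thesis by (simp add: C_def c0_def mult_ac)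
qed

end
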